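(* Assume: (A1) the solution set $S_1$ of the variational inequality is nonempty; (A3) $F$ has a stochastic oracle $F_\xi$ that is variable $\bar L$-Lipschitz in mean; (A4) $\|F(x)-F(y)\|_*\le L\|x-y\|$ for all $x,y\in K$; (A5) there exist $x^*\in K$ and $\rho>0$ such that $-\rho\|w\|_*^2\le\langle w,x-x^*\rangle$ for all $x\in K$ and all $w\in F(x)+\partial(g+\mathrm I_K)(x)$; (A6) for some $L_f>0$, $\|\nabla f(x)-\nabla f(y)\|_*\le L_f\|x-y\|$ for all $x,y\in K$. Let $\{x_s\}$ be generated by the algorithm, and suppose that one of the following two sets of parameter conditions holds. (a) $0<p<1$, $p<\gamma<1$, $\sigma_1>0$ and $\frac{8(\gamma-p)L_f^2}{(1-p)\alpha^2}-\frac{\sigma_2}{\sigma_1}\left(\frac{\gamma-p}{1-p}\left(1-\frac{8\rho L_f^2}{\alpha}\right)-\frac12\right)\le0$, where $\sigma_1=\frac{1-\gamma}{2(1-p)}\left(1-\frac{8\rho L_f^2}{\alpha}\right)-\left(2\alpha^2L^2+8\alpha\rho L^2+\frac{4\alpha\rho\bar L^2}{b}+\frac{5\alpha^2\bar L^2}{2b}\right)$ and $\sigma_2=8L^2+\frac{4(1-\gamma)L_f^2}{(1-p)\alpha^2}+\frac{4\bar L^2}{b}$. (b) $p=1$, $\sigma_1'>0$ and $(1-\gamma)\left(\frac{\sigma_1'}{\sigma_2'}\left(\frac{8\rho L_f^2}{\alpha}-1\right)+\frac{8L_f^2}{\alpha^2}\right)\le0$, where $\sigma_1'=\left(\gamma-\frac12\right)-\left(4\alpha^2L^2+16\alpha\rho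 L^2+\frac{8\alpha\rho\bar L^2}{b}+\frac{5\alpha^2\bar L^2}{b}+\frac{8\gamma\rho L_f^2}{\alpha}\right)$ and $\sigma_2'=16L^2+\frac{8\gamma L_f^2}{\alpha^2}+\frac{8\bar L^2}{b}$. Then for every $\epsilon>0$, within $S=\mathcal O\left(\frac1{\epsilon^2}\right)$ iterations there is $s\in\{1,\dots,S\}$ such that $$\mathbb E\left[\mathrm{dist}\big(\mathbf 0,F(x_s)+\partial(g+\mathrm I_K)(x_s)\big)\right]\le\epsilon;$$ that is, to achieve an $\epsilon$-approximated solution, the total complexity in $S$ iterations is $\mathcal O\left(\frac1{\epsilon^2}\right)$.
   Context: Setting. $\mathcal X$ is a finite-dimensional space with inner product $\langle\cdot,\cdot\rangle$ and a norm $\|\cdot\|$ with dual norm $\|\cdot\|_*$. $K\subset\mathcal X$ is nonempty, closed and convex, with indicator function $\mathrm I_K$ ($0$ on $K$, $+\infty$ elsewhere); $g:K\to(-\infty,+\infty]$ is proper, convex, lower semicontinuous; $F:\mathrm{dom}\,g\to\mathcal X$ is an operator of the form $F=\frac1M\sum_{i=1}^M F_i$. The variational inequality is: find $x^*\in K$ with $\langle F(x^* ),y-x^*\rangle+g(y)-g(x^* )\ge 0$ for all $y\in K$; $S_1$ is its solution set. $\partial$ denotes the convex subdifferential. A point $\bar x\in K$ is an $\epsilon$-approximated solution if $\mathrm{dist}(\mathbf 0,F(\bar x)+\partial(g+\mathrm I_K)(\bar x))=\min_{u\in\partial(g+\mathrm I_K)(\bar x)}\|F(\bar x)+u\|_*\le\epsilon$.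 Bregman distance. $f:K\to(-\infty,+\infty]$ is proper, convex, lower semicontinuous, $\mathrm{dom}\,g\subset\mathrm{dom}\,f$, $f$ is differentiable on $\mathrm{dom}(\partial f)=\{x\in\mathrm{dom} f:\partial f(x)\ne\emptyset\}$ and 1-strongly convex: $f(x)\ge f(y)+\langle\nabla f(y),x-y\rangle+\frac12\|x-y\|^2$ for $x\in\mathrm{dom} f$, $y\in\mathrm{dom}(\partial f)$. $D(x,y)=f(x)-f(y)-\langle\nabla f(y),x-y\rangle$ for $x\in\mathrm{dom}\,g$, $y\in\mathrm{dom}(\partial f)$. Stochastic oracle. $F$ has a stochastic oracle $F_\xi$ that is variable $\bar L$-Lipschitz in mean if for any $x,y\in\mathrm{dom}\,g$ there is a distribution $Q_{x,y}$ of $\xi$ such that (i) $F(z)=\mathbb E_{\xi\sim Q_{x,y}}[F_\xi(z)]$ for all $z\in\mathrm{dom}\,g$; (ii) $\mathbb E_{\xi\sim Q_{x,y}}[\|F_\xi(x)-F_\xi(y)\|_*^2]\le\bar L^2\|x-y\|^2$. Algorithm. Parameters: $0<\gamma\le1$, $0<p\le1$, stepsize $\alpha>0$, batch size $b\in\{1,\dots,M\}$. Start with $x_0=x_{-1}=w_0=w_{-1}\in K$. For $s=0,1,\dots,S-1$: draw $\xi^s_1,\dots,\xi^s_b\in\{1,\dots,M\}$ independently from $Q_{x_s,w_{s-1}}$ and set $B^s=\{\xi_1^s,\dots,\xi_b^s\}$ (with multiplicity); set $\bar x_s=(\nabla f)^{-1}\big(\gamma\nabla f(x_s)+(1-\gamma)\nabla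 f(x_{s-1})\big)$; $\Delta^s=\frac1b\sum_{\xi\in B^s}\big(F(w_s)+F_\xi(x_s)-F_\xi(w_{s-1})\big)$; $x_{s+1}=\arg\min_{x\in K}\{\alpha g(x)+\langle\alpha\Delta^s,x\rangle+D(x,\bar x_s)\}$; and let $w_{s+1}=x_{s+1}$ with probability $p$ and $w_{s+1}=x_s$ with probability $1-p$ (fresh independent coin). All iterates are assumed well defined, i.e. the points used as second arguments of $D$ lie in $\mathrm{dom}(\partial f)$. The constants hidden in $\mathcal O$ do not depend on $\epsilon$ (they may depend on the problem data, the parameters and $D(x^*,x_0)$). *)

theory Defs
  imports "HOL-Probability.Probability"
begin

text \<open>
  The space is an arbitrary \<open>'a :: euclidean_space\<close>; its inner product is \<open>\<bullet>\<close>, and the norm \<open>N\<close> of the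
  problem is any norm on it, not necessarily the one induced by \<open>\<bullet>\<close>.
\<close>

definition is_norm :: "('a::real_vector \<Rightarrow> real) \<Rightarrow> bool" where
  "is_norm N \<longleftrightarrow>
     (\<forall>x. 0 \<le> N x) \<and> (\<forall>x. N x = 0 \<longleftrightarrow> x = 0) \<and>
     (\<forall>c x. N (c *\<^sub>R x) = \<bar>c\<bar> * N x) \<and> (\<forall>x y. N (x + y) \<le> N x + N y)"

definition dual_norm :: "('a::real_inner \<Rightarrow> real) \<Rightarrow> 'a \<Rightarrow> real" where
  "dual_norm N u = (SUP x\<in>{x. N x \<le> 1}. u \<bullet> x)"


text \<open>
  A function from \<open>K\<close> to \<open>(-\<infinity>, +\<infinity>]\<close> is a total \<open>'a \<Rightarrow> ereal\<close> whose values off \<open>K\<close> are irrelevant.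
\<close>

definition eff_dom :: "'a set \<Rightarrow> ('a \<Rightarrow> ereal) \<Rightarrow> 'a set" where
  "eff_dom K h = {x \<in> K. h x < \<infinity>}"

definition proper_on :: "'a set \<Rightarrow> ('a \<Rightarrow> ereal) \<Rightarrow> bool" where
  "proper_on K h \<longleftrightarrow> (\<forall>x\<in>K. h x \<noteq> -\<infinity>) \<and> eff_dom K h \<noteq> {}"

definition ereal_convex_on :: "'a::real_vector set \<Rightarrow> ('a \<Rightarrow> ereal) \<Rightarrow> bool" where
  "ereal_convex_on K h \<longleftrightarrow> convex K \<and>
     (\<forall>x\<in>K. \<forall>y\<in>K. \<forall>t\<in>{0..1}.
        h ((1 - t) *\<^sub>R x + t *\<^sub>R y) \<le> ereal (1 - t) * h x + ereal t * h y)"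

definition lsc_on :: "'a::topological_space set \<Rightarrow> ('a \<Rightarrow> ereal) \<Rightarrow> bool" where
  "lsc_on K h \<longleftrightarrow> (\<forall>x\<in>K. h x \<le> Liminf (at x within K) h)"

definition ind :: "'a set \<Rightarrow> 'a \<Rightarrow> ereal" where
  "ind K x = (if x \<in> K then 0 else \<infinity>)"

definition subdifferential :: "('a::real_inner \<Rightarrow> ereal) \<Rightarrow> 'a \<Rightarrow> 'a set" where
  "subdifferential h x = {u. h x < \<infinity> \<and> (\<forall>y. h x + ereal (u \<bullet> (y - x)) \<le> h y)}"

text \<open>\<open>dom(\<partial>f)\<close> for \<open>f\<close> given on \<open>K\<close> and extended by \<open>+\<infinity>\<close>.\<close>

definition dom_subdiff :: "'a::real_inner set \<Rightarrow> ('a \<Rightarrow> ereal) \<Rightarrow> 'a set" where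
  "dom_subdiff K f = {x \<in> eff_dom K f. subdifferential (\<lambda>z. f z + ind K z) x \<noteq> {}}"

text \<open>
  Differentiability of \<open>f\<close> on \<open>dom(\<partial>f)\<close> with gradient \<open>gf\<close>. Since \<open>f\<close> lives on \<open>K\<close>, the derivative is
  taken within \<open>dom f\<close>; at interior points this is the usual gradient, and at boundary points \<open>gf\<close>
  still represents the derivative of \<open>f\<close> along \<open>dom f\<close>. With the derivative \<open>at x\<close> instead,
  \<open>K \<subseteq> dom(\<partial>f)\<close> would force \<open>K = UNIV\<close>.
\<close>

definition gradient_on_dom_subdiff ::
    "'a::real_inner set \<Rightarrow> ('a \<Rightarrow> ereal) \<Rightarrow> ('a \<Rightarrow> 'a) \<Rightarrow> bool" where
  "gradient_on_dom_subdiff K f gf \<longleftrightarrow>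
     (\<forall>x\<in>dom_subdiff K f.
        ((\<lambda>z. real_of_ereal (f z)) has_derivative (\<lambda>h. gf x \<bullet> h)) (at x within eff_dom K f))"

definition strongly_convex_1 ::
    "('a::real_inner \<Rightarrow> real) \<Rightarrow> 'a set \<Rightarrow> ('a \<Rightarrow> ereal) \<Rightarrow> ('a \<Rightarrow> 'a) \<Rightarrow> bool" where
  "strongly_convex_1 N K f gf \<longleftrightarrow>
     (\<forall>x\<in>eff_dom K f. \<forall>y\<in>dom_subdiff K f.
        f x \<ge> f y + ereal (gf y \<bullet> (x - y) + 1/2 * (N (x - y))\<^sup>2))"

text \<open>Meaningful when \<open>f x\<close> and \<open>f y\<close> are finite.\<close>

definition bregman :: "('a::real_inner \<Rightarrow> ereal) \<Rightarrow> ('a \<Rightarrow> 'a) \<Rightarrow> 'a \<Rightarrow> 'a \<Rightarrow> real" where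
  "bregman f gf x y = real_of_ereal (f x) - real_of_ereal (f y) - gf y \<bullet> (x - y)"


text \<open>
  A solution lies in \<open>dom g\<close> because \<open>F\<close> is only given there; this also keeps
  \<open>g y - g x\<close> away from \<open>\<infinity> - \<infinity>\<close>, which is \<open>\<infinity>\<close> on \<^typ>\<open>ereal\<close>.
\<close>

definition VI_solutions ::
    "'a::real_inner set \<Rightarrow> ('a \<Rightarrow> ereal) \<Rightarrow> ('a \<Rightarrow> 'a) \<Rightarrow> 'a set" where
  "VI_solutions K g F =
     {x \<in> eff_dom K g. \<forall>y\<in>K. ereal (F x \<bullet> (y - x)) + g y - g x \<ge> 0}"

definition VI_operator ::
    "'a::real_inner set \<Rightarrow> ('a \<Rightarrow> ereal) \<Rightarrow> ('a \<Rightarrow> 'a) \<Rightarrow> 'a \<Rightarrow> 'a set" where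
  "VI_operator K g F x = (\<lambda>u. F x + u) ` subdifferential (\<lambda>z. g z + ind K z) x"

text \<open>Distance of \<open>0\<close> to a set in the dual norm; it is \<open>\<infinity>\<close> for the empty set.\<close>

definition dual_dist0 :: "('a::real_inner \<Rightarrow> real) \<Rightarrow> 'a set \<Rightarrow> ennreal" where
  "dual_dist0 N A = (INF w\<in>A. ennreal (dual_norm N w))"


text \<open>
  \<open>FO \<xi>\<close> is the oracle \<open>F\<^sub>\<xi>\<close>, with \<open>\<xi> \<in> {1..M}\<close>, and \<open>Q x y\<close> the distribution \<open>Q\<^bsub>x,y\<^esub>\<close>. The \<open>FO \<xi>\<close> need
  not be the components of \<open>F\<close> (importance sampling rescales them, for instance).
\<close>

definition variable_Lipschitz_oracle ::
    "('a::euclidean_space \<Rightarrow> real) \<Rightarrow> 'a set \<Rightarrow> ('a \<Rightarrow> ereal) \<Rightarrow> ('a \<Rightarrow> 'a) \<Rightarrow> nat \<Rightarrow>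
     (nat \<Rightarrow> 'a \<Rightarrow> 'a) \<Rightarrow> ('a \<Rightarrow> 'a \<Rightarrow> nat pmf) \<Rightarrow> real \<Rightarrow> bool" where
  "variable_Lipschitz_oracle N K g F M FO Q Lbar \<longleftrightarrow>
     (\<forall>x y. set_pmf (Q x y) \<subseteq> {1..M}) \<and>
     (\<forall>x\<in>eff_dom K g. \<forall>y\<in>eff_dom K g.
        (\<forall>z\<in>eff_dom K g. F z = measure_pmf.expectation (Q x y) (\<lambda>\<xi>. FO \<xi> z)) \<and>
        measure_pmf.expectation (Q x y) (\<lambda>\<xi>. (dual_norm N (FO \<xi> x - FO \<xi> y))\<^sup>2)
          \<le> Lbar\<^sup>2 * (N (x - y))\<^sup>2)"


text \<open>
  \<open>(\<nabla>f)\<^sup>-\<^sup>1(\<gamma> \<nabla>f(x) + (1 - \<gamma>) \<nabla>f(x'))\<close>; the inverse is unambiguous since strong convexity makes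
  \<open>\<nabla>f\<close> injective on \<open>dom(\<partial>f)\<close>.
\<close>

definition mirror_average ::
    "'a::real_inner set \<Rightarrow> ('a \<Rightarrow> ereal) \<Rightarrow> ('a \<Rightarrow> 'a) \<Rightarrow> real \<Rightarrow> 'a \<Rightarrow> 'a \<Rightarrow> 'a" where
  "mirror_average K f gf \<gamma> x x' =
     inv_into (dom_subdiff K f) gf (\<gamma> *\<^sub>R gf x + (1 - \<gamma>) *\<^sub>R gf x')"

definition estimator ::
    "('a::real_vector \<Rightarrow> 'a) \<Rightarrow> (nat \<Rightarrow> 'a \<Rightarrow> 'a) \<Rightarrow> nat \<Rightarrow> 'a \<Rightarrow> 'a \<Rightarrow> 'a \<Rightarrow> nat list \<Rightarrow> 'a" where
  "estimator F FO b x w w' B = (1 / real b) *\<^sub>R (\<Sum>\<xi>\<leftarrow>B. F w + FO \<xi> x - FO \<xi> w')"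

definition prox_step ::
    "'a::real_inner set \<Rightarrow> ('a \<Rightarrow> ereal) \<Rightarrow> ('a \<Rightarrow> ereal) \<Rightarrow> ('a \<Rightarrow> 'a) \<Rightarrow> real \<Rightarrow> 'a \<Rightarrow> 'a \<Rightarrow> 'a" where
  "prox_step K g f gf \<alpha> \<Delta> xbar =
     arg_min (\<lambda>x. ereal \<alpha> * g x + ereal ((\<alpha> *\<^sub>R \<Delta>) \<bullet> x + bregman f gf x xbar)) (\<lambda>x. x \<in> K)"

text \<open>
  The law of \<open>(x\<^sub>s, x\<^bsub>s-1\<^esub>, w\<^sub>s, w\<^bsub>s-1\<^esub>)\<close>. Each step draws a batch of \<open>b\<close> independent indices (a list, so
  with multiplicity) from \<open>Q\<^bsub>x\<^sub>s,w\<^sub>s\<^sub>-\<^sub>1\<^esub>\<close> and a fresh independent coin.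
\<close>

fun iterate_law ::
    "'a::euclidean_space set \<Rightarrow> ('a \<Rightarrow> ereal) \<Rightarrow> ('a \<Rightarrow> 'a) \<Rightarrow> (nat \<Rightarrow> 'a \<Rightarrow> 'a) \<Rightarrow>
     ('a \<Rightarrow> 'a \<Rightarrow> nat pmf) \<Rightarrow> ('a \<Rightarrow> ereal) \<Rightarrow> ('a \<Rightarrow> 'a) \<Rightarrow>
     real \<Rightarrow> real \<Rightarrow> real \<Rightarrow> nat \<Rightarrow> 'a \<Rightarrow> nat \<Rightarrow> ('a \<times> 'a \<times> 'a \<times> 'a) pmf" where
  "iterate_law K g F FO Q f gf \<gamma> p \<alpha> b x0 0 = return_pmf (x0, x0, x0, x0)"
| "iterate_law K g F FO Q f gf \<gamma> p \<alpha> b x0 (Suc s) =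
     bind_pmf (iterate_law K g F FO Q f gf \<gamma> p \<alpha> b x0 s) (\<lambda>(x, x', w, w').
       bind_pmf (replicate_pmf b (Q x w')) (\<lambda>B.
         bind_pmf (bernoulli_pmf p) (\<lambda>coin.
           let x_new = prox_step K g f gf \<alpha> (estimator F FO b x w w' B)
                         (mirror_average K f gf \<gamma> x x')
           in return_pmf (x_new, x, if coin then x_new else x, w))))"

text \<open>
  The iterates reached with positive probability lie in \<open>dom(\<partial>f)\<close>, and so do the mirror averages: the
  inverse image defining them exists.
\<close>

definition iterates_well_defined ::
    "'a::euclidean_space set \<Rightarrow> ('a \<Rightarrow> ereal) \<Rightarrow> ('a \<Rightarrow> 'a) \<Rightarrow> (nat \<Rightarrow> 'a \<Rightarrow> 'a) \<Rightarrow>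
     ('a \<Rightarrow> 'a \<Rightarrow> nat pmf) \<Rightarrow> ('a \<Rightarrow> ereal) \<Rightarrow> ('a \<Rightarrow> 'a) \<Rightarrow>
     real \<Rightarrow> real \<Rightarrow> real \<Rightarrow> nat \<Rightarrow> 'a \<Rightarrow> bool" where
  "iterates_well_defined K g F FO Q f gf \<gamma> p \<alpha> b x0 \<longleftrightarrow>
     (\<forall>s. \<forall>(x, x', w, w') \<in> set_pmf (iterate_law K g F FO Q f gf \<gamma> p \<alpha> b x0 s).
        x \<in> dom_subdiff K f \<and> x' \<in> dom_subdiff K f \<and>
        \<gamma> *\<^sub>R gf x + (1 - \<gamma>) *\<^sub>R gf x' \<in> gf ` dom_subdiff K f)"

definition expected_residual ::
    "('a::euclidean_space \<Rightarrow> real) \<Rightarrow> 'a set \<Rightarrow> ('a \<Rightarrow> ereal) \<Rightarrow> ('a \<Rightarrow> 'a) \<Rightarrow>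
     ('a \<times> 'a \<times> 'a \<times> 'a) pmf \<Rightarrow> ennreal" where
  "expected_residual N K g F P =
     (\<integral>\<^sup>+ (x, x', w, w'). dual_dist0 N (VI_operator K g F x) \<partial>measure_pmf P)"

end

theory Submission
  imports Defs
begin

text \<open>
  The proof is a descent argument for the potential
  \<open>D(x\<^sup>*, x\<^sub>s) + (1 - \<gamma>) D(x\<^sup>*, x\<^bsub>s-1\<^esub>) - \<alpha> \<langle>F(x\<^sub>s) - F(w\<^bsub>s-1\<^esub>), x\<^sub>s - x\<^sup>*\<rangle> + A \<parallel>x\<^sub>s - w\<^bsub>s-1\<^esub>\<parallel>\<^sup>2\<close>,
  which is nonnegative. Each proximal step produces an element of \<open>F(x) + \<partial>(g + I\<^sub>K)(x)\<close> at the new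
  iterate; the weak Minty inequality for this element bounds the new potential by the old one plus
  \<open>\<alpha> \<rho>\<close> times its squared dual norm and some sampling errors, minus Bregman distances between nearby
  iterates. Under the parameter conditions these distances pay for the errors with room to spare, so
  they still do when \<open>\<rho>\<close> is replaced by a slightly larger \<open>r\<close>. Running the descent with \<open>r\<close> leaves the
  surplus \<open>\<alpha> (r - \<rho>)\<close> times the squared residual in every step. Hence the expected squared residuals
  have a bounded sum, and among the first \<open>C / \<epsilon>\<^sup>2\<close> of them one is at most \<open>\<epsilon>\<^sup>2\<close>; Jensen's inequality
  gives the claim.

  Three points need care.

  First, the norm is arbitrary, and in a general norm averaging \<open>b\<close> independent vectors does not divide
  their second moment by \<open>b\<close>. The mirror map repairs this. By strong convexity, the conjugate of
  \<open>D(\<cdot>, z)\<close> is 1-smooth with respect to the dual norm, so its expectation along a sum of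
  independent vectors grows only by half of their individual second moments
  (\<open>expectation_bregman_conj_batch\<close>). At \<open>z = x\<^sub>s\<close> this replaces the Cauchy-Schwarz and Young estimate
  of \<open>\<langle>oracle mean, x\<^bsub>s+1\<^esub> - x\<^sub>s\<rangle>\<close> (\<open>batch_Young\<close>). At a point \<open>z\<close> of the relative interior of \<open>K\<close>,
  combined with the Lipschitz bound on \<open>\<nabla>f\<close>, it gives a type-2 inequality with constant \<open>L\<^sub>f\<^sup>2\<close> for the
  dual norm, up to vectors orthogonal to \<open>K\<close> (\<open>batch_representative\<close>). This constant is affordable
  because every occurrence comes with the factor \<open>\<rho> L\<^sub>f\<^sup>2 / \<alpha>\<close>, which the conditions keep at most \<open>1/16\<close>.

  Second, the coin that selects \<open>w\<^sub>s\<close> enters the estimator and therefore \<open>x\<^bsub>s+1\<^esub>\<close>, so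
  \<open>E \<parallel>x\<^bsub>s+1\<^esub> - w\<^sub>s\<parallel>\<^sup>2\<close> is not the \<open>p\<close>-mixture of \<open>\<parallel>x\<^bsub>s+1\<^esub> - x\<^sub>s\<parallel>\<^sup>2\<close> and \<open>\<parallel>x\<^bsub>s+1\<^esub> - x\<^bsub>s-1\<^esub>\<parallel>\<^sup>2\<close>. The
  two outcomes of the coin are compared for the same batch: they differ by at most
  \<open>\<alpha> L \<parallel>x\<^sub>s - x\<^bsub>s-1\<^esub>\<parallel>\<close>, because the proximal step is nonexpansive, and the constants in \<open>\<sigma>\<^sub>1\<close> leave
  enough room for that (\<open>coupled_distances\<close>, \<open>coin_average\<close>).

  Third, the starting point may lie outside \<open>dom g\<close>, where the oracle is uncontrolled. After three
  steps all points fed to the oracle lie in \<open>dom g\<close>; the earlier residuals are finite since the laws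
  of the iterates have finite support, and they only enter the constant.
\<close>

section \<open>A norm and its dual\<close>

text \<open>
  The norm of the problem, in general different from the Euclidean one; its dual norm is taken with
  respect to the inner product.
\<close>

locale dual_pair =
  fixes N :: "'a::euclidean_space \<Rightarrow> real"
  assumes is_norm: "is_norm N"
begin

abbreviation Nd where "Nd \<equiv> dual_norm N"

lemma N_nonneg [simp]: "0 \<le> N x" and N_eq_0 [simp]: "N x = 0 \<longleftrightarrow> x = 0"
  and N_scale: "N (c *\<^sub>R x) = \<bar>c\<bar> * N x" and N_add: "N (x + y) \<le> N x + N y"
  using is_norm unfolding is_norm_def by auto

lemma N_zero [simp]: "N 0 = 0" using N_eq_0[of 0] by simp

lemma N_minus: "N (- x) = N x" using N_scale[of "-1" x] by simp

lemma N_commute: "N (x - y) = N (y - x)" using N_minus[of "x - y"] by simp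

lemma N_triangle: "N (x - z) \<le> N (x - y) + N (y - z)" using N_add[of "x - y" "y - z"] by simp

lemma N_le_norm: "\<exists>C\<ge>0. \<forall>x. N x \<le> C * norm x"
proof -
  have "N x \<le> (\<Sum>b\<in>Basis. N b) * norm x" for x
  proof -
    have sum: "N (\<Sum>b\<in>A. (x \<bullet> b) *\<^sub>R b) \<le> (\<Sum>b\<in>A. \<bar>x \<bullet> b\<bar> * N b)" if "finite A" for A
      using that
    proof (induction A)
      case (insert a A)
      then show ?case
        using N_add[of "(x \<bullet> a) *\<^sub>R a" "\<Sum>b\<in>A. (x \<bullet> b) *\<^sub>R b"] by (simp add: N_scale)
    qed simp
    have "N x \<le> (\<Sum>b\<in>Basis. \<bar>x \<bullet> b\<bar> * N b)" using sum[of Basis] by (simp add: euclidean_representation)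
    also have "\<dots> \<le> (\<Sum>b\<in>Basis. norm x * N b)"
      by (intro sum_mono mult_right_mono) (auto intro: Basis_le_norm)
    finally show ?thesis by (simp add: sum_distrib_left mult.commute)
  qed
  then show ?thesis by (intro exI[of _ "\<Sum>b\<in>Basis. N b"]) (auto intro: sum_nonneg)
qed

lemma N_continuous: "continuous_on A N"
proof -
  obtain C where C: "C \<ge> 0" "\<And>x. N x \<le> C * norm x" using N_le_norm by blast
  have "\<bar>N x - N y\<bar> \<le> C * norm (x - y)" for x y
    using N_add[of "x - y" y] N_add[of "y - x" x] C(2)[of "x - y"] N_commute[of x y] by auto
  then have "C-lipschitz_on A N"
    using C by (intro lipschitz_onI) (auto simp: dist_norm)
  then show ?thesis by (rule lipschitz_on_continuous_on)
qed

lemma norm_le_N: "\<exists>c>0. \<forall>x. c * norm x \<le> N x"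
proof -
  have ne: "sphere (0::'a) 1 \<noteq> {}" by simp
  obtain y where y: "y \<in> sphere 0 1" "\<And>x. x \<in> sphere 0 1 \<Longrightarrow> N y \<le> N x"
    using continuous_attains_inf[OF compact_sphere ne N_continuous] by blast
  have "N y > 0" using y(1) N_eq_0[of y] N_nonneg[of y] by (auto simp: less_le)
  moreover have "N y * norm x \<le> N x" for x
  proof (cases "x = 0")
    case False
    have "N y \<le> N ((1 / norm x) *\<^sub>R x)" using False by (intro y(2)) simp
    then show ?thesis using False by (simp add: N_scale field_simps)
  qed simp
  ultimately show ?thesis by blast
qed

lemma dual_bdd: "bdd_above ((\<lambda>x. u \<bullet> x) ` {x. N x \<le> 1})"
proof -
  obtain c where c: "c > 0" "\<And>x. c * norm x \<le> N x" using norm_le_N by blast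
  have "u \<bullet> x \<le> norm u * (1 / c)" if "N x \<le> 1" for x
  proof -
    have "norm x \<le> 1 / c" using c that by (simp add: field_simps) (metis c(2) order_trans mult.commute)
    then show ?thesis
      using norm_cauchy_schwarz[of u x] mult_left_mono[of "norm x" "1/c" "norm u"] by auto
  qed
  then show ?thesis by (intro bdd_aboveI2[where M = "norm u * (1/c)"]) auto
qed

lemma inner_le_dual: "u \<bullet> x \<le> Nd u * N x"
proof (cases "x = 0")
  case False
  then have pos: "N x > 0" using N_nonneg[of x] by (simp add: less_le del: N_nonneg)
  have "u \<bullet> ((1 / N x) *\<^sub>R x) \<le> Nd u"
    unfolding dual_norm_def using pos by (intro cSUP_upper dual_bdd) (simp add: N_scale)
  then show ?thesis using pos by (simp add: field_simps)
qed simp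

lemma dual_least: "(\<And>x. N x \<le> 1 \<Longrightarrow> u \<bullet> x \<le> c) \<Longrightarrow> Nd u \<le> c"
  unfolding dual_norm_def by (rule cSUP_least) (auto intro!: exI[of _ 0])

lemma Nd_nonneg [simp]: "0 \<le> Nd u"
  unfolding dual_norm_def by (rule cSUP_upper2[OF dual_bdd, of 0]) auto

lemma Nd_add: "Nd (u + v) \<le> Nd u + Nd v"
proof (rule dual_least)
  fix x assume "N x \<le> 1"
  then have "Nd u * N x \<le> Nd u" "Nd v * N x \<le> Nd v" by (simp_all add: mult_left_le)
  then show "(u + v) \<bullet> x \<le> Nd u + Nd v"
    using inner_le_dual[of u x] inner_le_dual[of v x] by (simp add: inner_add_left)
qed

lemma Nd_scale_le: "Nd (c *\<^sub>R u) \<le> \<bar>c\<bar> * Nd u"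
proof (rule dual_least)
  fix x assume x: "N x \<le> 1"
  have "(c *\<^sub>R u) \<bullet> x = u \<bullet> (c *\<^sub>R x)" by simp
  also have "\<dots> \<le> Nd u * (\<bar>c\<bar> * N x)" using inner_le_dual[of u "c *\<^sub>R x"] by (simp add: N_scale)
  also have "\<dots> \<le> Nd u * (\<bar>c\<bar> * 1)" using x by (intro mult_left_mono) auto
  finally show "(c *\<^sub>R u) \<bullet> x \<le> \<bar>c\<bar> * Nd u" by (simp add: mult.commute)
qed

lemma Nd_zero [simp]: "Nd 0 = 0"
  using Nd_scale_le[of 0 0] Nd_nonneg[of 0] by (simp del: Nd_nonneg)

lemma Nd_scale: "Nd (c *\<^sub>R u) = \<bar>c\<bar> * Nd u"
proof (cases "c = 0")
  case False
  have "Nd u \<le> \<bar>1/c\<bar> * Nd (c *\<^sub>R u)" using Nd_scale_le[of "1/c" "c *\<^sub>R u"] False by simp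
  then show ?thesis using Nd_scale_le[of c u] False by (simp add: field_simps abs_divide)
qed simp

lemma Nd_minus: "Nd (- u) = Nd u" using Nd_scale[of "-1" u] by simp

lemma Nd_commute: "Nd (u - v) = Nd (v - u)" using Nd_minus[of "u - v"] by simp

lemma inner_le_Young: "u \<bullet> x \<le> (Nd u)\<^sup>2 / 2 + (N x)\<^sup>2 / 2"
  using inner_le_dual[of u x] sum_squares_bound[of "Nd u" "N x"] by simp

text \<open>
  A weighted Cauchy-Schwarz inequality; the reciprocals of \<open>8/3\<close>, \<open>8/3\<close> and \<open>4\<close> add up to 1. With the
  weight 4 the gradient part of the residual costs exactly the terms with \<open>8 \<rho> L\<^sub>f\<^sup>2 / \<alpha>\<close> in the parameter
  conditions.
\<close>

lemma Nd_sum_sq3: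
  "(Nd (u + v + w))\<^sup>2 \<le> 8/3 * (Nd u)\<^sup>2 + 8/3 * (Nd v)\<^sup>2 + 4 * (Nd w)\<^sup>2"
proof -
  have "Nd (u + v + w) \<le> Nd u + Nd v + Nd w"
    using Nd_add[of "u + v" w] Nd_add[of u v] by simp
  then have "(Nd (u + v + w))\<^sup>2 \<le> (Nd u + Nd v + Nd w)\<^sup>2" by (intro power_mono) auto
  also have "\<dots> \<le> 8/3 * (Nd u)\<^sup>2 + 8/3 * (Nd v)\<^sup>2 + 4 * (Nd w)\<^sup>2"
  proof -
    have id: "8/3 * a\<^sup>2 + 8/3 * b\<^sup>2 + 4 * c\<^sup>2 - (a + b + c)\<^sup>2
        = (5/3) * (a - 3/5 * b - 3/5 * c)\<^sup>2 + (16/15) * (b - 3/2 * c)\<^sup>2" for a b c :: real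
      by (simp add: power2_eq_square algebra_simps)
    have "0 \<le> (5/3) * (a - 3/5 * b - 3/5 * c)\<^sup>2 + (16/15) * (b - 3/2 * c)\<^sup>2" for a b c :: real
      by simp
    then show ?thesis using id[of "Nd u" "Nd v" "Nd w"] by (metis diff_ge_0_iff_ge)
  qed
  finally show ?thesis .
qed

end

section \<open>Mirror maps and proximal steps\<close>

text \<open>
  The hypothesis is lower semicontinuity in neighbourhood form: it survives adding a continuous
  function without any case distinction on infinite values.
\<close>

lemma lsc_on_attains_min:
  fixes h :: "'a::topological_space \<Rightarrow> ereal"
  assumes h: "\<And>x r. x \<in> C \<Longrightarrow> r < h x \<Longrightarrow> \<exists>U. open U \<and> x \<in> U \<and> (\<forall>y\<in>C \<inter> U. r < h y)"
    and C: "compact C" "C \<noteq> {}"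
  shows "\<exists>x\<in>C. \<forall>y\<in>C. h x \<le> h y"
proof (rule ccontr)
  \<comment> \<open>If no point is a minimizer, every point has a neighbourhood beaten by some value of \<open>h\<close>;
    finitely many of these values beat all of \<open>C\<close>, in particular the point attaining the least of them.\<close>
  assume "\<not> ?thesis"
  then have "\<forall>x\<in>C. \<exists>y\<in>C. h y < h x" by (meson not_le)
  then obtain y where y: "\<And>x. x \<in> C \<Longrightarrow> y x \<in> C \<and> h (y x) < h x" by metis
  have "\<forall>x\<in>C. \<exists>U. open U \<and> x \<in> U \<and> (\<forall>z\<in>C \<inter> U. h (y x) < h z)"
    using h y by blast
  then obtain U where U: "\<And>x. x \<in> C \<Longrightarrow> open (U x) \<and> x \<in> U x \<and> (\<forall>z\<in>C \<inter> U x. h (y x) < h z)"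
    by metis
  have "C \<subseteq> (\<Union>x\<in>C. U x)" using U by blast
  then obtain T where T: "T \<subseteq> C" "finite T" "C \<subseteq> (\<Union>x\<in>T. U x)"
    using compactE_image[OF C(1), of C U] U by metis
  have "T \<noteq> {}" using T C by auto
  then obtain t where t: "t \<in> T" "\<And>x. x \<in> T \<Longrightarrow> h (y t) \<le> h (y x)"
    using Min_in[of "(\<lambda>x. h (y x)) ` T"] Min_le[of "(\<lambda>x. h (y x)) ` T"] T(2) by fastforce
  have "y t \<in> C" using y t T by blast
  then obtain x where "x \<in> T" "y t \<in> U x" using T by blast
  then have "h (y x) < h (y t)" using U \<open>y t \<in> C\<close> T by blast
  then show False using t \<open>x \<in> T\<close> by (meson not_le)
qed

lemma lsc_on_neighbourhood:
  assumes "lsc_on K h" "x \<in> K" "r < h x"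
  shows "\<exists>U. open U \<and> x \<in> U \<and> (\<forall>y\<in>K \<inter> U. r < h y)"
proof -
  have "r < Liminf (at x within K) h" using assms unfolding lsc_on_def by (meson less_le_trans)
  then have "eventually (\<lambda>y. r < h y) (at x within K)" by (rule less_LiminfD)
  then obtain U where "open U" "x \<in> U" "\<forall>y\<in>U. y \<noteq> x \<longrightarrow> y \<in> K \<longrightarrow> r < h y"
    unfolding eventually_at_topological by blast
  then show ?thesis using assms by (intro exI[of _ U]) auto
qed

text \<open>
  On the unit ball around a point \<open>z\<close> of its domain \<open>g\<close> has a minimum. Farther out, convexity on the
  segment from \<open>z\<close> bounds \<open>g\<close> by the line through its values at \<open>z\<close> and on the unit sphere.
\<close>

lemma proper_convex_lsc_minorant:
  fixes g :: "'a::euclidean_space \<Rightarrow> ereal"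
  assumes K: "closed K" and g: "proper_on K g" "ereal_convex_on K g" "lsc_on K g"
  shows "\<exists>A B. 0 \<le> A \<and> (\<forall>x\<in>K. ereal (B - A * norm x) \<le> g x)"
proof -
  obtain z where z: "z \<in> K" "g z < \<infinity>" using g(1) by (auto simp: proper_on_def eff_dom_def)
  then obtain gz where gz: "g z = ereal gz" using g(1) by (cases "g z") (auto simp: proper_on_def)
  have "\<exists>x\<in>K \<inter> cball z 1. \<forall>y\<in>K \<inter> cball z 1. g x \<le> g y"
  proof (rule lsc_on_attains_min)
    fix x r assume "x \<in> K \<inter> cball z 1" "r < g x"
    then show "\<exists>U. open U \<and> x \<in> U \<and> (\<forall>y\<in>K \<inter> cball z 1 \<inter> U. r < g y)"
      using lsc_on_neighbourhood[OF g(3), of x r] by blast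
  qed (use K z in \<open>auto simp: closed_Int_compact\<close>)
  then obtain u where u: "u \<in> K" "\<And>y. y \<in> K \<inter> cball z 1 \<Longrightarrow> g u \<le> g y" by blast
  have "g u \<le> g z" using u(2)[of z] z by simp
  then obtain m where m: "g u = ereal m" "m \<le> gz"
    using g(1) u(1) gz by (cases "g u") (auto simp: proper_on_def)
  have low: "ereal (m - (gz - m) * norm (x - z)) \<le> g x" if x: "x \<in> K" for x
  proof (cases "norm (x - z) \<le> 1")
    case True
    then have "ereal m \<le> g x" using u(2)[of x] x m by (simp add: dist_norm norm_minus_commute)
    moreover have "m - (gz - m) * norm (x - z) \<le> m" using m(2) by simp
    ultimately show ?thesis by (metis ereal_less_eq(3) order_trans)
  next
    case False
    define d where "d = norm (x - z)"
    have d: "d > 1" using False d_def by simp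
    define y where "y = (1 - 1/d) *\<^sub>R z + (1/d) *\<^sub>R x"
    have y: "y \<in> K" using g(2) d x z unfolding y_def ereal_convex_on_def
      by (intro convexD) (auto simp: field_simps)
    have "y - z = (1/d) *\<^sub>R (x - z)" unfolding y_def by (simp add: algebra_simps)
    then have "norm (y - z) = 1" using d unfolding d_def by (cases "x = z") auto
    then have "ereal m \<le> g y" using u(2)[of y] y m by (simp add: dist_norm norm_minus_commute)
    also have "g y \<le> ereal (1 - 1/d) * g z + ereal (1/d) * g x"
    proof -
      have "1/d \<in> {0..1}" using d by simp
      then show ?thesis using g(2) x z(1) unfolding y_def ereal_convex_on_def by blast
    qed
    finally have le: "ereal m \<le> ereal (1 - 1/d) * ereal gz + ereal (1/d) * g x" using gz by simp
    show ?thesis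
    proof (cases "g x")
      case (real r)
      then have "m \<le> (1 - 1/d) * gz + r / d" using le by simp
      then have "d * m \<le> d * ((1 - 1/d) * gz + r / d)" using d by (intro mult_left_mono) auto
      also have "\<dots> = d * gz - gz + r" using d by (simp add: field_simps)
      finally have "m - (gz - m) * d \<le> r" using m(2) by (simp add: algebra_simps)
      then show ?thesis using real d_def by simp
    qed (use g(1) x in \<open>auto simp: proper_on_def\<close>)
  qed
  have "ereal ((m - (gz - m) * norm z) - (gz - m) * norm x) \<le> g x" if x: "x \<in> K" for x
  proof -
    have "(gz - m) * norm (x - z) \<le> (gz - m) * (norm x + norm z)"
      using m(2) norm_triangle_ineq4[of x z] by (intro mult_left_mono) auto
    then have "(m - (gz - m) * norm z) - (gz - m) * norm x \<le> m - (gz - m) * norm (x - z)"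
      by (simp add: algebra_simps)
    then show ?thesis using low[OF x] by (metis ereal_less_eq(3) order_trans)
  qed
  then show ?thesis using m(2) by (intro exI[of _ "gz - m"] exI[of _ "m - (gz - m) * norm z"]) auto
qed

lemma bregman_three_point:
  "bregman f gf x z = bregman f gf x y + bregman f gf y z + (gf y - gf z) \<bullet> (x - y)"
  by (simp add: bregman_def algebra_simps)

lemma bregman_symmetrized: "bregman f gf x y + bregman f gf y x = (gf x - gf y) \<bullet> (x - y)"
  by (simp add: bregman_def algebra_simps)

text \<open>
  A 1-strongly convex distance-generating function that is finite and differentiable on all of \<open>K\<close>,
  the derivative being taken within \<open>K\<close>. Only Bregman distances of \<open>f\<close> matter, so strong convexity is
  stated for them.
\<close>

locale mirror_map = dual_pair N for N :: "'a::euclidean_space \<Rightarrow> real" +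
  fixes K :: "'a set" and f :: "'a \<Rightarrow> ereal" and gf :: "'a \<Rightarrow> 'a"
  assumes K: "closed K" "convex K" "K \<noteq> {}"
    and gradient: "x \<in> K \<Longrightarrow> ((\<lambda>z. real_of_ereal (f z)) has_derivative (\<lambda>h. gf x \<bullet> h)) (at x within K)"
    and strong: "x \<in> K \<Longrightarrow> y \<in> K \<Longrightarrow> (N (x - y))\<^sup>2 / 2 \<le> bregman f gf x y"
begin

abbreviation D where "D \<equiv> bregman f gf"

lemma bregman_nonneg: "x \<in> K \<Longrightarrow> y \<in> K \<Longrightarrow> 0 \<le> D x y"
  using strong[of x y] by (smt (verit) zero_le_power2 divide_nonneg_nonneg)

lemma gradient_strongly_monotone:
  "x \<in> K \<Longrightarrow> y \<in> K \<Longrightarrow> (N (x - y))\<^sup>2 \<le> (gf x - gf y) \<bullet> (x - y)"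
  using strong[of x y] strong[of y x] bregman_symmetrized[of f gf x y] N_commute[of x y] by simp

lemma bregman_continuous: "continuous_on K (\<lambda>x. D x y)"
proof -
  have "continuous_on K (\<lambda>x. real_of_ereal (f x))"
    using gradient has_derivative_continuous continuous_on_eq_continuous_within by blast
  then show ?thesis unfolding bregman_def by (intro continuous_intros)
qed

text \<open>
  The quadratic growth of the Bregman distance dominates the linear decay that \<open>g\<close> and the inner product
  can have, so the minimization may be restricted to a compact set, where lower semicontinuity suffices.
\<close>

lemma prox_exists:
  fixes g :: "'a \<Rightarrow> ereal" and \<alpha> :: real and d y :: 'a
  assumes g: "proper_on K g" "ereal_convex_on K g" "lsc_on K g" and "0 < \<alpha>" and y: "y \<in> K"
  defines "h \<equiv> \<lambda>x. ereal \<alpha> * g x + ereal ((\<alpha> *\<^sub>R d) \<bullet> x + D x y)"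
  shows "\<exists>x\<in>K. \<forall>z\<in>K. h x \<le> h z"
proof -
  obtain A B where A: "0 \<le> A" and AB: "\<And>x. x \<in> K \<Longrightarrow> ereal (B - A * norm x) \<le> g x"
    using proper_convex_lsc_minorant[OF K(1) g] by blast
  obtain c where c: "c > 0" "\<And>x. c * norm x \<le> N x" using norm_le_N by blast
  \<comment> \<open>\<open>P\<close> is a slope that exceeds the largest possible linear decay by 1; the quadratic
    \<open>(c t)\<^sup>2 / 2\<close> lies above the line \<open>P t - P\<^sup>2 / (2 c\<^sup>2)\<close>.\<close>
  define P where "P = \<alpha> * A + norm (\<alpha> *\<^sub>R d) + 1"
  define k where "k = \<alpha> * B - P * norm y - P\<^sup>2 / (2 * c\<^sup>2)"
  have grow: "ereal (k + norm x) \<le> h x" if x: "x \<in> K" for x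
  proof -
    have D: "P * norm (x - y) - P\<^sup>2 / (2 * c\<^sup>2) \<le> D x y"
    proof -
      have "P * norm (x - y) \<le> (P/c)\<^sup>2/2 + (c * norm (x - y))\<^sup>2/2"
        using sum_squares_bound[of "P/c" "c * norm (x - y)"] c(1) by simp
      moreover have "(c * norm (x - y))\<^sup>2 \<le> (N (x - y))\<^sup>2" using c by (intro power_mono) auto
      ultimately show ?thesis using strong[OF x y] by (simp add: power_divide)
    qed
    have P: "0 \<le> P" unfolding P_def using A \<open>0 < \<alpha>\<close> by simp
    have "norm x - norm y \<le> norm (x - y)" by (rule norm_triangle_ineq2)
    then have "P * (norm x - norm y) \<le> P * norm (x - y)" using P by (rule mult_left_mono)
    moreover have "- (norm (\<alpha> *\<^sub>R d) * norm x) \<le> (\<alpha> *\<^sub>R d) \<bullet> x"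
      using Cauchy_Schwarz_ineq2[of "\<alpha> *\<^sub>R d" x] by linarith
    ultimately have real: "k + norm x \<le> \<alpha> * (B - A * norm x) + ((\<alpha> *\<^sub>R d) \<bullet> x + D x y)"
      using D unfolding k_def by (simp add: P_def algebra_simps)
    have "ereal \<alpha> * ereal (B - A * norm x) \<le> ereal \<alpha> * g x"
      using AB[OF x] \<open>0 < \<alpha>\<close> by (intro ereal_mult_left_mono) auto
    then have "ereal (\<alpha> * (B - A * norm x)) + ereal ((\<alpha> *\<^sub>R d) \<bullet> x + D x y) \<le> h x"
      unfolding h_def by (intro add_mono) auto
    then show ?thesis using real by (metis ereal_less_eq(3) order_trans plus_ereal.simps(1))
  qed
  obtain z where z: "z \<in> K" "g z < \<infinity>" using g(1) by (auto simp: proper_on_def eff_dom_def)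
  then obtain gz where "g z = ereal gz" using g(1) by (cases "g z") (auto simp: proper_on_def)
  then obtain hz where hz: "h z = ereal hz" unfolding h_def by simp
  define C where "C = K \<inter> cball 0 (max (norm z) (hz - k))"
  have zC: "z \<in> C" using z C_def by simp
  have "\<exists>x\<in>C. \<forall>y\<in>C. h x \<le> h y"
  proof (rule lsc_on_attains_min)
    show "compact C" unfolding C_def using K by (simp add: closed_Int_compact)
    show "C \<noteq> {}" using zC by blast
    fix x r assume x: "x \<in> C" and r: "r < h x"
    define q where "q x = (\<alpha> *\<^sub>R d) \<bullet> x + D x y" for x
    have cont: "continuous_on K q" unfolding q_def by (intro continuous_intros bregman_continuous)
    obtain s where s1: "r < ereal s" "ereal s < h x" using ereal_dense2[OF r] by blast
    obtain t where t1: "ereal s < ereal t" "ereal t < h x" using ereal_dense2[OF s1(2)] by blast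
    note s = s1(1) t1
    have xK: "x \<in> K" using x C_def by simp
    have "ereal ((t - q x) / \<alpha>) < g x"
      using s(3) \<open>0 < \<alpha>\<close> unfolding h_def q_def[symmetric]
      by (cases "g x") (auto simp: field_simps)
    from lsc_on_neighbourhood[OF g(3) xK this]
    obtain U where U: "open U" "x \<in> U" "\<And>y. y \<in> K \<inter> U \<Longrightarrow> ereal ((t - q x) / \<alpha>) < g y"
      by (elim exE conjE) simp
    have "eventually (\<lambda>y. q x - (t - s) < q y) (at x within K)"
      using cont xK s(2) by (intro order_tendstoD) (auto simp: continuous_on_def)
    then obtain W where W: "open W" "x \<in> W" "\<And>y. y \<in> W \<Longrightarrow> y \<noteq> x \<Longrightarrow> y \<in> K \<Longrightarrow> q x - (t - s) < q y"
      unfolding eventually_at_topological by blast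
    have "r < h v" if v: "v \<in> C \<inter> (U \<inter> W)" for v
    proof -
      have 1: "ereal ((t - q x) / \<alpha>) < g v" using U(3)[of v] v C_def by simp
      have 2: "q x - (t - s) < q v" using W(3)[of v] v C_def s(2) by (cases "v = x") auto
      have "ereal s \<le> h v"
      proof (cases "g v")
        case (real gv)
        then have "t - q x < \<alpha> * gv" using 1 \<open>0 < \<alpha>\<close> by (simp add: field_simps)
        then show ?thesis using 2 real by (simp add: h_def q_def)
      qed (use 1 \<open>0 < \<alpha>\<close> in \<open>auto simp: h_def\<close>)
      then show ?thesis using s(1) by (rule less_le_trans[rotated])
    qed
    then show "\<exists>U. open U \<and> x \<in> U \<and> (\<forall>y\<in>C \<inter> U. r < h y)"
      using U W by (intro exI[of _ "U \<inter> W"]) auto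
  qed
  then obtain x where x: "x \<in> C" "\<And>y. y \<in> C \<Longrightarrow> h x \<le> h y" by blast
  have "h x \<le> h v" if v: "v \<in> K" for v
  proof (cases "v \<in> C")
    case False
    then have "hz < k + norm v" using v unfolding C_def by auto
    then have "h z \<le> h v" using grow[OF v] hz by (metis ereal_less_eq(3) less_imp_le order_trans)
    then show ?thesis using x(2)[OF zC] by (rule order_trans[rotated])
  qed (rule x(2))
  then show ?thesis using x(1) C_def by blast
qed

text \<open>
  Moving from the minimizer \<open>x\<close> towards \<open>v\<close> changes the smooth part by its directional derivative to
  first order, and \<open>g\<close> by at most the slope of the chord. Working with difference quotients along
  segments avoids any sum rule for subdifferentials.
\<close>

lemma prox_optimality:
  assumes g: "proper_on K g" "ereal_convex_on K g" and "0 < \<alpha>" and y: "y \<in> K" and x: "x \<in> K"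
    and min: "\<And>z. z \<in> K \<Longrightarrow> ereal \<alpha> * g x + ereal ((\<alpha> *\<^sub>R d) \<bullet> x + D x y)
                \<le> ereal \<alpha> * g z + ereal ((\<alpha> *\<^sub>R d) \<bullet> z + D z y)"
  shows "x \<in> eff_dom K g"
    and "(1/\<alpha>) *\<^sub>R (gf y - gf x) - d \<in> subdifferential (\<lambda>z. g z + ind K z) x"
proof -
  obtain z where z: "z \<in> K" "g z < \<infinity>" using g(1) by (auto simp: proper_on_def eff_dom_def)
  have "g x \<noteq> \<infinity>" using min[OF z(1)] z \<open>0 < \<alpha>\<close> by (cases "g z") auto
  then obtain gx where gx: "g x = ereal gx" using g(1) x by (cases "g x") (auto simp: proper_on_def)
  then show "x \<in> eff_dom K g" using x by (simp add: eff_dom_def)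
  let ?u = "(1/\<alpha>) *\<^sub>R (gf y - gf x) - d"
  have "g x + ereal (?u \<bullet> (v - x)) \<le> g v" if v: "v \<in> K" for v
  proof (cases "g v")
    case (real gv)
    define q where "q s = ((\<alpha> *\<^sub>R d) \<bullet> (x + s *\<^sub>R (v - x)) + D (x + s *\<^sub>R (v - x)) y)" for s
    have pt: "x + s *\<^sub>R (v - x) = (1 - s) *\<^sub>R x + s *\<^sub>R v" for s by (simp add: algebra_simps)
    have inK: "x + s *\<^sub>R (v - x) \<in> K" if "s \<in> {0..1}" for s
      unfolding pt using K(2) x v that by (intro convexD) auto
    have step: "- (\<alpha> * (gv - gx)) \<le> (q s - q 0) / s" if s: "s \<in> {0<..1}" for s
    proof -
      let ?w = "x + s *\<^sub>R (v - x)"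
      have s01: "s \<in> {0..1}" using s by auto
      have "g ?w \<le> ereal (1 - s) * g x + ereal s * g v"
        using g(2) x v s01 unfolding pt ereal_convex_on_def by blast
      then have gw: "g ?w \<le> ereal ((1 - s) * gx + s * gv)" using gx real by simp
      then obtain r where r: "g ?w = ereal r" using g(1) inK[OF s01]
        by (cases "g ?w") (auto simp: proper_on_def)
      have "\<alpha> * gx + q 0 \<le> \<alpha> * r + q s"
        using min[OF inK[OF s01]] gx r by (simp add: q_def)
      moreover have "\<alpha> * r \<le> \<alpha> * ((1 - s) * gx + s * gv)"
        using gw r \<open>0 < \<alpha>\<close> by (intro mult_left_mono) auto
      ultimately have "s * (- (\<alpha> * (gv - gx))) \<le> q s - q 0" by (simp add: algebra_simps)
      then show ?thesis using s by (simp add: field_simps)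
    qed
    have seg: "((\<lambda>s. x + s *\<^sub>R (v - x)) has_derivative (\<lambda>h. h *\<^sub>R (v - x))) (at 0 within {0..1})"
      by (auto intro!: derivative_eq_intros)
    have "((\<lambda>z. real_of_ereal (f z)) has_derivative (\<lambda>h. gf x \<bullet> h))
        (at (x + 0 *\<^sub>R (v - x)) within (\<lambda>s. x + s *\<^sub>R (v - x)) ` {0..1})"
      using gradient[OF x] inK by (intro has_derivative_subset[where s = K and t = "_ ` _"]) auto
    from has_derivative_in_compose[OF seg this]
    have line: "((\<lambda>s. real_of_ereal (f (x + s *\<^sub>R (v - x)))) has_derivative
        (\<lambda>h. gf x \<bullet> (h *\<^sub>R (v - x)))) (at 0 within {0..1})" .
    have "((\<lambda>s. real_of_ereal (f (x + s *\<^sub>R (v - x)))) has_real_derivative gf x \<bullet> (v - x))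
        (at 0 within {0..1})"
      by (rule has_derivative_imp_has_field_derivative[OF line]) simp
    moreover have "((\<lambda>s. ((\<alpha> *\<^sub>R d) \<bullet> x - real_of_ereal (f y) - gf y \<bullet> (x - y))
          + s * ((\<alpha> *\<^sub>R d - gf y) \<bullet> (v - x)))
        has_real_derivative (\<alpha> *\<^sub>R d - gf y) \<bullet> (v - x)) (at 0 within {0..1})"
      using DERIV_add[OF DERIV_const DERIV_cmult_right[OF DERIV_ident]] by force
    moreover have "q = (\<lambda>s. real_of_ereal (f (x + s *\<^sub>R (v - x))) +
        (((\<alpha> *\<^sub>R d) \<bullet> x - real_of_ereal (f y) - gf y \<bullet> (x - y))
          + s * ((\<alpha> *\<^sub>R d - gf y) \<bullet> (v - x))))"
      by (simp add: fun_eq_iff q_def bregman_def algebra_simps inner_add_right inner_diff_right)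
    ultimately have "(q has_real_derivative (gf x \<bullet> (v - x) + (\<alpha> *\<^sub>R d - gf y) \<bullet> (v - x)))
        (at 0 within {0..1})"
      by (simp only: DERIV_add)
    moreover have "gf x \<bullet> (v - x) + (\<alpha> *\<^sub>R d - gf y) \<bullet> (v - x) = (\<alpha> *\<^sub>R d + gf x - gf y) \<bullet> (v - x)"
      by (simp add: inner_add_left inner_diff_left)
    ultimately have "(q has_real_derivative ((\<alpha> *\<^sub>R d + gf x - gf y) \<bullet> (v - x))) (at 0 within {0..1})"
      by simp
    then have "((\<lambda>s. (q s - q 0) / s) \<longlongrightarrow> (\<alpha> *\<^sub>R d + gf x - gf y) \<bullet> (v - x)) (at 0 within {0..1})"
      by (simp add: has_field_derivative_iff)
    moreover have "eventually (\<lambda>s. - (\<alpha> * (gv - gx)) \<le> (q s - q 0) / s) (at 0 within {0..1})"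
      using step by (auto simp: eventually_at_filter intro!: always_eventually)
    moreover have "at (0::real) within {0..1} \<noteq> bot"
      by (simp add: at_within_Icc_at_right)
    ultimately have "- (\<alpha> * (gv - gx)) \<le> (\<alpha> *\<^sub>R d + gf x - gf y) \<bullet> (v - x)"
      by (intro tendsto_lowerbound) auto
    then have "\<alpha> * (?u \<bullet> (v - x)) \<le> \<alpha> * (gv - gx)"
      using \<open>0 < \<alpha>\<close> by (simp add: inner_diff_left inner_add_left right_diff_distrib)
    then have "?u \<bullet> (v - x) \<le> gv - gx" using \<open>0 < \<alpha>\<close> by simp
    then show ?thesis using gx real by simp
  qed (use g(1) v in \<open>auto simp: proper_on_def\<close>)
  then have "g x + ind K x + ereal (?u \<bullet> (v - x)) \<le> g v + ind K v" for v
    using x g(1) gx by (cases "v \<in> K") (auto simp: ind_def proper_on_def)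
  then show "?u \<in> subdifferential (\<lambda>z. g z + ind K z) x"
    using gx x by (simp add: subdifferential_def ind_def)
qed

end

section \<open>Variance reduction through the conjugate of the Bregman distance\<close>

lemma finite_replicate_pmf: "finite (set_pmf p) \<Longrightarrow> finite (set_pmf (replicate_pmf n p))"
  unfolding set_replicate_pmf using finite_lists_length_eq[of "set_pmf p" n]
  by (auto simp: lists_eq_set)

lemma expectation_bind_finite:
  fixes h :: "'b \<Rightarrow> real"
  assumes "finite (set_pmf p)" "\<And>x. x \<in> set_pmf p \<Longrightarrow> finite (set_pmf (q x))"
  shows "measure_pmf.expectation (bind_pmf p q) h
    = measure_pmf.expectation p (\<lambda>x. measure_pmf.expectation (q x) h)"
  using assms by (subst pmf_expectation_bind[where A = "set_pmf p"])
    (auto simp: integral_measure_pmf_real[where A = "set_pmf p"] mult.commute)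

lemma expectation_mono_finite:
  fixes g h :: "'b \<Rightarrow> real"
  assumes "finite (set_pmf p)" "\<And>x. x \<in> set_pmf p \<Longrightarrow> g x \<le> h x"
  shows "measure_pmf.expectation p g \<le> measure_pmf.expectation p h"
  using assms by (intro integral_mono_AE integrable_measure_pmf_finite) (auto simp: AE_measure_pmf_iff)

lemma expectation_replicate_Suc:
  fixes h :: "'b list \<Rightarrow> real"
  assumes "finite (set_pmf p)"
  shows "measure_pmf.expectation (replicate_pmf (Suc n) p) h =
    measure_pmf.expectation p (\<lambda>i. measure_pmf.expectation (replicate_pmf n p) (\<lambda>B. h (i # B)))"
  using assms by (simp add: expectation_bind_finite finite_replicate_pmf)

lemma expectation_sum_list_replicate:
  fixes X :: "'i \<Rightarrow> 'a::euclidean_space"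
  assumes fin: "finite (set_pmf p)"
  shows "measure_pmf.expectation (replicate_pmf n p) (\<lambda>B. (\<Sum>i\<leftarrow>B. X i) \<bullet> y)
    = real n * (measure_pmf.expectation p X \<bullet> y)"
proof (induction n)
  case (Suc n)
  note int = integrable_measure_pmf_finite[OF fin]
    and intr = integrable_measure_pmf_finite[OF finite_replicate_pmf[OF fin]]
  have "measure_pmf.expectation (replicate_pmf (Suc n) p) (\<lambda>B. (\<Sum>i\<leftarrow>B. X i) \<bullet> y)
    = measure_pmf.expectation p (\<lambda>i. measure_pmf.expectation (replicate_pmf n p)
        (\<lambda>B. X i \<bullet> y + (\<Sum>i\<leftarrow>B. X i) \<bullet> y))"
    by (subst expectation_replicate_Suc[OF fin]) (simp add: inner_add_left)
  also have "\<dots> = measure_pmf.expectation p (\<lambda>i. X i \<bullet> y + real n * (measure_pmf.expectation p X \<bullet> y))"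
    by (subst Bochner_Integration.integral_add[OF intr intr]) (simp add: Suc)
  also have "\<dots> = real (Suc n) * (measure_pmf.expectation p X \<bullet> y)"
    by (subst Bochner_Integration.integral_add[OF int int])
      (simp add: integral_inner_left[OF int] algebra_simps)
  finally show ?case .
qed simp

context mirror_map
begin

text \<open>
  For \<open>z \<in> K\<close> the supremum of \<open>gap z y\<close> over \<open>K\<close> is the convex conjugate, at \<open>y\<close>, of \<open>v \<mapsto> D(z + v, z)\<close>
  on \<open>K - z\<close>. The supremum is attained, since maximizing it is a proximal step with \<open>g = 0\<close>.
\<close>

definition gap where "gap z y h = y \<bullet> (h - z) - D h z"

definition conj_point where "conj_point z y = (SOME h. h \<in> K \<and> (\<forall>k\<in>K. gap z y k \<le> gap z y h))"

definition bregman_conj where "bregman_conj z y = gap z y (conj_point z y)"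

lemma conj_point:
  assumes z: "z \<in> K"
  shows "conj_point z y \<in> K" and "k \<in> K \<Longrightarrow> gap z y k \<le> bregman_conj z y"
    and "k \<in> K \<Longrightarrow> (y - (gf (conj_point z y) - gf z)) \<bullet> (k - conj_point z y) \<le> 0"
proof -
  have zero: "proper_on K (\<lambda>_. 0)" "ereal_convex_on K (\<lambda>_. 0)" "lsc_on K (\<lambda>_. 0)"
    using K by (auto simp: proper_on_def eff_dom_def ereal_convex_on_def lsc_on_def
        intro: Liminf_bounded)
  obtain h where h: "h \<in> K" "\<And>v. v \<in> K \<Longrightarrow> - (y \<bullet> h) + D h z \<le> - (y \<bullet> v) + D v z"
    using prox_exists[OF zero zero_less_one z, of "-y"] by auto
  have "\<exists>h. h \<in> K \<and> (\<forall>k\<in>K. gap z y k \<le> gap z y h)"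
    using h by (intro exI[of _ h]) (force simp: gap_def inner_diff_right)
  from someI_ex[OF this] have c: "conj_point z y \<in> K"
    and max: "\<And>k. k \<in> K \<Longrightarrow> gap z y k \<le> gap z y (conj_point z y)"
    unfolding conj_point_def by blast+
  then show "conj_point z y \<in> K" "k \<in> K \<Longrightarrow> gap z y k \<le> bregman_conj z y"
    unfolding bregman_conj_def by auto
  have "(1/1) *\<^sub>R (gf z - gf (conj_point z y)) - (- y)
      \<in> subdifferential (\<lambda>v. 0 + ind K v) (conj_point z y)"
  proof (rule prox_optimality(2)[OF zero(1,2) zero_less_one z c])
    fix v assume "v \<in> K"
    then show "ereal 1 * 0 + ereal ((1 *\<^sub>R - y) \<bullet> conj_point z y + D (conj_point z y) z)
        \<le> ereal 1 * 0 + ereal ((1 *\<^sub>R - y) \<bullet> v + D v z)"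
      using max[of v] by (simp add: gap_def inner_diff_right)
  qed
  then have "ind K (conj_point z y) + ereal ((gf z - gf (conj_point z y) + y) \<bullet> (k - conj_point z y))
      \<le> ind K k"
    by (auto simp: subdifferential_def)
  then show "k \<in> K \<Longrightarrow> (y - (gf (conj_point z y) - gf z)) \<bullet> (k - conj_point z y) \<le> 0"
    using c by (simp add: ind_def algebra_simps)
qed

text \<open>
  Strong convexity of \<open>D(\<cdot>, z)\<close> makes its conjugate 1-smooth, with \<open>conj_point z y - z\<close> as gradient.
  By optimality of the old maximizer, switching to a new one costs its Bregman distance to the old
  one, and Young's inequality pays for this distance with half the squared dual norm of the increment.
\<close>

lemma bregman_conj_smooth:
  assumes z: "z \<in> K"
  shows "bregman_conj z (y + u) \<le> bregman_conj z y + u \<bullet> (conj_point z y - z) + (Nd u)\<^sup>2 / 2"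
proof -
  let ?h = "conj_point z y" and ?k = "conj_point z (y + u)"
  note hk = conj_point(1)[OF z, of y] conj_point(1)[OF z, of "y + u"]
  have "gap z (y + u) ?k = gap z y ?h + u \<bullet> (?h - z) + (y - (gf ?h - gf z)) \<bullet> (?k - ?h)
      + (u \<bullet> (?k - ?h) - D ?k ?h)"
    using bregman_three_point[of f gf ?k z ?h]
    by (simp add: gap_def inner_diff_left inner_diff_right inner_add_left)
  moreover have "(y - (gf ?h - gf z)) \<bullet> (?k - ?h) \<le> 0" using conj_point(3)[OF z hk(2)] .
  moreover have "u \<bullet> (?k - ?h) - D ?k ?h \<le> (Nd u)\<^sup>2 / 2"
    using inner_le_Young[of u "?k - ?h"] strong[OF hk(2,1)] by simp
  ultimately show ?thesis unfolding bregman_conj_def by linarith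
qed

lemma bregman_conj_le: "z \<in> K \<Longrightarrow> bregman_conj z y \<le> (Nd y)\<^sup>2 / 2"
  using inner_le_Young[of y "conj_point z y - z"] strong[of "conj_point z y" z] conj_point(1)[of z y]
  by (simp add: bregman_conj_def gap_def)

text \<open>
  Smoothness bounds the left-hand side by the tangent at \<open>y\<close>, evaluated at the mean, plus half a second
  moment; convexity puts the tangent below the conjugate at the shifted point. Using convexity here
  makes the second moment appear about 0 instead of about the mean; in a general norm, centering
  could double the norm.
\<close>

lemma expectation_bregman_conj_add:
  assumes z: "z \<in> K" and fin: "finite (set_pmf p)"
  shows "measure_pmf.expectation p (\<lambda>i. bregman_conj z (y + X i))
    \<le> bregman_conj z (y + measure_pmf.expectation p X) + measure_pmf.expectation p (\<lambda>i. (Nd (X i))\<^sup>2) / 2"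
proof -
  let ?h = "conj_point z y" and ?v = "measure_pmf.expectation p X"
  note int = integrable_measure_pmf_finite[OF fin]
  have "measure_pmf.expectation p (\<lambda>i. bregman_conj z (y + X i))
      \<le> measure_pmf.expectation p (\<lambda>i. (bregman_conj z y + X i \<bullet> (?h - z)) + (Nd (X i))\<^sup>2 / 2)"
    using bregman_conj_smooth[OF z] by (intro expectation_mono_finite fin)
  also have "\<dots> = measure_pmf.expectation p (\<lambda>i. bregman_conj z y + X i \<bullet> (?h - z))
      + measure_pmf.expectation p (\<lambda>i. (Nd (X i))\<^sup>2 / 2)"
    by (rule Bochner_Integration.integral_add) (rule int)+
  also have "measure_pmf.expectation p (\<lambda>i. bregman_conj z y + X i \<bullet> (?h - z))
      = bregman_conj z y + ?v \<bullet> (?h - z)"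
    by (subst Bochner_Integration.integral_add) (auto intro: int simp: integral_inner_left[OF int])
  also have "bregman_conj z y + ?v \<bullet> (?h - z) = gap z (y + ?v) ?h"
    by (simp add: bregman_conj_def gap_def inner_add_left)
  finally show ?thesis
    using conj_point(2)[OF z conj_point(1)[OF z, of y], of "y + ?v"] by simp
qed

text \<open>
  Adding the samples one by one, each contributes its own second moment only. This is the
  variance reduction: for samples scaled by \<open>1 / n\<close> the last term is of order \<open>1 / n\<close>.
\<close>

lemma expectation_bregman_conj_batch:
  assumes z: "z \<in> K" and fin: "finite (set_pmf p)"
  shows "measure_pmf.expectation (replicate_pmf n p) (\<lambda>B. bregman_conj z (y + (\<Sum>i\<leftarrow>B. X i)))
    \<le> bregman_conj z (y + real n *\<^sub>R measure_pmf.expectation p X)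
      + real n * measure_pmf.expectation p (\<lambda>i. (Nd (X i))\<^sup>2) / 2"
proof (induction n arbitrary: y)
  case (Suc n)
  let ?v = "measure_pmf.expectation p X" and ?c = "measure_pmf.expectation p (\<lambda>i. (Nd (X i))\<^sup>2)"
  have "measure_pmf.expectation (replicate_pmf (Suc n) p) (\<lambda>B. bregman_conj z (y + (\<Sum>i\<leftarrow>B. X i)))
    = measure_pmf.expectation p (\<lambda>i. measure_pmf.expectation (replicate_pmf n p)
        (\<lambda>B. bregman_conj z ((y + X i) + (\<Sum>i\<leftarrow>B. X i))))"
    by (subst expectation_replicate_Suc[OF fin]) (simp add: add.assoc)
  also have "\<dots> \<le> measure_pmf.expectation p
      (\<lambda>i. bregman_conj z ((y + real n *\<^sub>R ?v) + X i) + real n * ?c / 2)"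
  proof (intro expectation_mono_finite fin)
    fix i
    show "measure_pmf.expectation (replicate_pmf n p)
          (\<lambda>B. bregman_conj z ((y + X i) + (\<Sum>i\<leftarrow>B. X i)))
        \<le> bregman_conj z ((y + real n *\<^sub>R ?v) + X i) + real n * ?c / 2"
      using Suc[of "y + X i"] by (simp add: ac_simps)
  qed
  also have "\<dots> = measure_pmf.expectation p (\<lambda>i. bregman_conj z ((y + real n *\<^sub>R ?v) + X i))
      + real n * ?c / 2"
    by (subst Bochner_Integration.integral_add) (auto intro: integrable_measure_pmf_finite[OF fin])
  also have "\<dots> \<le> bregman_conj z ((y + real n *\<^sub>R ?v) + ?v) + ?c / 2 + real n * ?c / 2"
    using expectation_bregman_conj_add[OF z fin, of "y + real n *\<^sub>R ?v" X] by simp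
  finally show ?case by (simp add: algebra_simps add_divide_distrib)
qed simp

text \<open>
  The point \<open>k B\<close> may depend on the batch, as the next iterate does: the conjugate is the supremum over
  all choices.
\<close>

lemma batch_Young:
  assumes z: "z \<in> K" and fin: "finite (set_pmf p)"
    and k: "\<And>B. B \<in> set_pmf (replicate_pmf n p) \<Longrightarrow> k B \<in> K"
  shows "measure_pmf.expectation (replicate_pmf n p) (\<lambda>B. (\<Sum>i\<leftarrow>B. X i) \<bullet> (k B - z) - D (k B) z)
    \<le> (Nd (real n *\<^sub>R measure_pmf.expectation p X))\<^sup>2 / 2
      + real n * measure_pmf.expectation p (\<lambda>i. (Nd (X i))\<^sup>2) / 2"
proof -
  have "measure_pmf.expectation (replicate_pmf n p) (\<lambda>B. (\<Sum>i\<leftarrow>B. X i) \<bullet> (k B - z) - D (k B) z)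
     \<le> measure_pmf.expectation (replicate_pmf n p) (\<lambda>B. bregman_conj z (0 + (\<Sum>i\<leftarrow>B. X i)))"
    using conj_point(2)[OF z k] by (intro expectation_mono_finite finite_replicate_pmf fin) (simp add: gap_def)
  also note expectation_bregman_conj_batch[OF z fin]
  finally show ?thesis
    using bregman_conj_le[OF z, of "0 + real n *\<^sub>R measure_pmf.expectation p X"] by simp
qed

text \<open>
  A substitute for the bias-variance decomposition in the dual norm. The sum of the samples may be
  changed by vectors orthogonal to the differences of \<open>K\<close>, which subgradients of \<open>g + I\<^sub>K\<close> do not see;
  when \<open>K\<close> is lower-dimensional, \<open>f\<close> carries no information on the orthogonal directions, and no bound by
  \<open>L\<^sub>f\<close> could hold for the full sum. The representative is a difference \<open>\<nabla>f(h) - \<nabla>f(z)\<close>, rescaled: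
  its dual norm is at most \<open>L\<^sub>f \<parallel>h - z\<parallel>\<close>, and half of \<open>\<parallel>h - z\<parallel>\<^sup>2\<close> is bounded by the conjugate at the
  sum.
\<close>

lemma batch_representative:
  assumes fin: "finite (set_pmf p)"
    and Lf: "\<And>x y. x \<in> K \<Longrightarrow> y \<in> K \<Longrightarrow> Nd (gf x - gf y) \<le> Lf * N (x - y)"
  obtains e where
    "\<And>B k k'. B \<in> set_pmf (replicate_pmf n p) \<Longrightarrow> k \<in> K \<Longrightarrow> k' \<in> K \<Longrightarrow>
        e B \<bullet> (k - k') = (\<Sum>i\<leftarrow>B. X i) \<bullet> (k - k')"
    "measure_pmf.expectation (replicate_pmf n p) (\<lambda>B. (Nd (e B))\<^sup>2)
      \<le> Lf\<^sup>2 * ((Nd (real n *\<^sub>R measure_pmf.expectation p X))\<^sup>2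
               + real n * measure_pmf.expectation p (\<lambda>i. (Nd (X i))\<^sup>2))"
proof -
  let ?R = "replicate_pmf n p"
  let ?v = "measure_pmf.expectation p X" and ?c = "measure_pmf.expectation p (\<lambda>i. (Nd (X i))\<^sup>2)"
  define Y where "Y B = (\<Sum>i\<leftarrow>B. X i)" for B
  have finR: "finite (set_pmf ?R)" by (rule finite_replicate_pmf[OF fin])
  obtain z r where z: "z \<in> K" "r > 0" and ball: "ball z r \<inter> affine hull K \<subseteq> K"
    using rel_interior_eq_empty[OF K(2)] K(3) unfolding mem_rel_interior_ball
    by (metis all_not_in_conv mem_rel_interior_ball)
  obtain c where c: "c > 0" "\<And>x. c * norm x \<le> N x" using norm_le_N by blast
  define m where "m = (\<Sum>B\<in>set_pmf ?R. Nd (Y B))"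
  have m: "Nd (Y B) \<le> m" if "B \<in> set_pmf ?R" for B
    unfolding m_def using that finR by (intro member_le_sum) auto
  have m0: "0 \<le> m" unfolding m_def by (intro sum_nonneg) auto
  \<comment> \<open>Scaling the samples down keeps every maximizer inside the relative interior ball around \<open>z\<close>, where
    the optimality condition is an equation. Both sides of the claim are quadratic in the samples, so
    the scale drops out.\<close>
  define t where "t = c * r / (m + 1)"
  have t: "t > 0" unfolding t_def using c z m0 by simp
  define h where "h B = conj_point z (t *\<^sub>R Y B)" for B
  have hK: "h B \<in> K" for B unfolding h_def by (rule conj_point(1)[OF z(1)])
  have opt: "(t *\<^sub>R Y B - (gf (h B) - gf z)) \<bullet> (k - h B) \<le> 0" if "k \<in> K" for B k
    unfolding h_def by (rule conj_point(3)[OF z(1) that])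
  have near: "norm (h B - z) < r" if B: "B \<in> set_pmf ?R" for B
  proof -
    have "(N (h B - z))\<^sup>2 \<le> (gf (h B) - gf z) \<bullet> (h B - z)"
      by (rule gradient_strongly_monotone[OF hK z(1)])
    also have "\<dots> \<le> (t *\<^sub>R Y B) \<bullet> (h B - z)"
      using opt[OF z(1), of B] by (simp add: inner_diff_left inner_diff_right)
    also have "\<dots> \<le> t * Nd (Y B) * N (h B - z)"
      using inner_le_dual[of "t *\<^sub>R Y B" "h B - z"] t by (simp add: Nd_scale)
    finally have "N (h B - z) * N (h B - z) \<le> t * Nd (Y B) * N (h B - z)" by (simp add: power2_eq_square)
    then have "N (h B - z) \<le> t * Nd (Y B)"
      using t N_nonneg[of "h B - z"] by (cases "N (h B - z) = 0") (auto simp: mult_le_cancel_right)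
    also have "\<dots> \<le> t * m" using m[OF B] t by (intro mult_left_mono) auto
    also have "\<dots> < c * r" unfolding t_def using c z m0 by (simp add: field_simps)
    finally have "c * norm (h B - z) < c * r" using c(2)[of "h B - z"] by linarith
    then show ?thesis using c(1) by simp
  qed
  have ortho: "(gf (h B) - gf z) \<bullet> (k - k') = (t *\<^sub>R Y B) \<bullet> (k - k')"
    if B: "B \<in> set_pmf ?R" and k: "k \<in> K" "k' \<in> K" for B k k'
  proof -
    define s where "s = (r - norm (h B - z)) / (2 * (1 + norm (k - k')))"
    have s: "s > 0" unfolding s_def using near[OF B] by (simp add: add_pos_nonneg)
    have sn: "s * norm (k - k') < r - norm (h B - z)"
    proof -
      have "s * norm (k - k') \<le> s * (1 + norm (k - k'))" using s by simp
      also have "\<dots> = (r - norm (h B - z)) / 2"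
        unfolding s_def by (simp add: field_simps add_pos_nonneg add_nonneg_eq_0_iff)
      also have "\<dots> < r - norm (h B - z)" using near[OF B] by simp
      finally show ?thesis .
    qed
    have inK: "h B + \<sigma> *\<^sub>R (k - k') \<in> K" if "\<bar>\<sigma>\<bar> = s" for \<sigma>
    proof (rule subsetD[OF ball], rule IntI)
      have "norm (h B + \<sigma> *\<^sub>R (k - k') - z) \<le> norm (h B - z) + norm (\<sigma> *\<^sub>R (k - k'))"
        using norm_triangle_ineq[of "h B - z" "\<sigma> *\<^sub>R (k - k')"] by (simp add: algebra_simps)
      then show "h B + \<sigma> *\<^sub>R (k - k') \<in> ball z r"
        using sn that by (simp add: dist_norm norm_minus_commute)
      show "h B + \<sigma> *\<^sub>R (k - k') \<in> affine hull K"
        using hK k by (intro mem_affine_3_minus affine_affine_hull) (auto intro: hull_inc)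
    qed
    let ?w = "t *\<^sub>R Y B - (gf (h B) - gf z)"
    have "?w \<bullet> (\<sigma> *\<^sub>R (k - k')) \<le> 0" if "\<bar>\<sigma>\<bar> = s" for \<sigma>
      using opt[OF inK[OF that], of B] by simp
    from this[of s] this[of "-s"] have "s * (?w \<bullet> (k - k')) = 0" using s by simp
    then show ?thesis using s by (simp add: inner_diff_left)
  qed
  define e where "e B = (1/t) *\<^sub>R (gf (h B) - gf z)" for B
  have e: "(Nd (e B))\<^sup>2 \<le> (Lf/t)\<^sup>2 * 2 * bregman_conj z (0 + (\<Sum>i\<leftarrow>B. t *\<^sub>R X i))" for B
  proof -
    have scale: "(\<Sum>i\<leftarrow>B. t *\<^sub>R X i) = t *\<^sub>R Y B"
      unfolding Y_def by (induction B) (auto simp: scaleR_add_right)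
    have "Nd (e B) \<le> 1/t * (Lf * N (h B - z))"
      unfolding e_def Nd_scale using Lf[OF hK z(1), of B] t by (simp add: divide_right_mono)
    then have "(Nd (e B))\<^sup>2 \<le> (1/t * (Lf * N (h B - z)))\<^sup>2" by (intro power_mono) auto
    also have "\<dots> = (Lf/t)\<^sup>2 * (N (h B - z))\<^sup>2" by (simp add: power_mult_distrib power_divide)
    also have "\<dots> \<le> (Lf/t)\<^sup>2 * (2 * bregman_conj z (t *\<^sub>R Y B))"
    proof (rule mult_left_mono)
      have "(gf (h B) - gf z) \<bullet> (h B - z) \<le> (t *\<^sub>R Y B) \<bullet> (h B - z)"
        using opt[OF z(1), of B] by (simp add: inner_diff_left inner_diff_right)
      then have "D z (h B) \<le> bregman_conj z (t *\<^sub>R Y B)"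
        using bregman_symmetrized[of f gf "h B" z] by (simp add: bregman_conj_def gap_def h_def)
      then show "(N (h B - z))\<^sup>2 \<le> 2 * bregman_conj z (t *\<^sub>R Y B)"
        using strong[OF z(1) hK, of B] by (simp add: N_commute)
    qed simp
    finally show ?thesis using scale by simp
  qed
  have "measure_pmf.expectation ?R (\<lambda>B. (Nd (e B))\<^sup>2)
      \<le> measure_pmf.expectation ?R (\<lambda>B. (Lf/t)\<^sup>2 * 2 * bregman_conj z (0 + (\<Sum>i\<leftarrow>B. t *\<^sub>R X i)))"
    using e by (intro expectation_mono_finite finR)
  also have "\<dots> = (Lf/t)\<^sup>2 * 2 * measure_pmf.expectation ?R (\<lambda>B. bregman_conj z (0 + (\<Sum>i\<leftarrow>B. t *\<^sub>R X i)))"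
    by simp
  also have "\<dots> \<le> (Lf/t)\<^sup>2 * 2 * ((Nd (t *\<^sub>R (real n *\<^sub>R ?v)))\<^sup>2 / 2 + real n * (t\<^sup>2 * ?c) / 2)"
  proof (rule mult_left_mono)
    have *: "measure_pmf.expectation p (\<lambda>i. t *\<^sub>R X i) = t *\<^sub>R ?v" by simp
    have **: "measure_pmf.expectation p (\<lambda>i. (Nd (t *\<^sub>R X i))\<^sup>2) = t\<^sup>2 * ?c"
      by (simp add: Nd_scale power_mult_distrib)
    show "measure_pmf.expectation ?R (\<lambda>B. bregman_conj z (0 + (\<Sum>i\<leftarrow>B. t *\<^sub>R X i)))
        \<le> (Nd (t *\<^sub>R (real n *\<^sub>R ?v)))\<^sup>2 / 2 + real n * (t\<^sup>2 * ?c) / 2"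
      using expectation_bregman_conj_batch[OF z(1) fin, of n 0 "\<lambda>i. t *\<^sub>R X i"]
        bregman_conj_le[OF z(1), of "t *\<^sub>R (real n *\<^sub>R ?v)"]
      unfolding * ** by (simp add: mult.commute)
  qed simp
  also have "\<dots> = Lf\<^sup>2 * ((Nd (real n *\<^sub>R ?v))\<^sup>2 + real n * ?c)"
    using t by (simp add: Nd_scale power_mult_distrib power_divide field_simps)
  finally have "measure_pmf.expectation ?R (\<lambda>B. (Nd (e B))\<^sup>2) \<le> Lf\<^sup>2 * ((Nd (real n *\<^sub>R ?v))\<^sup>2 + real n * ?c)" .
  moreover have "e B \<bullet> (k - k') = (\<Sum>i\<leftarrow>B. X i) \<bullet> (k - k')"
    if "B \<in> set_pmf ?R" "k \<in> K" "k' \<in> K" for B k k'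
    using ortho[OF that] t by (simp add: e_def Y_def)
  ultimately show thesis using that by blast
qed

end

section \<open>Coupled outcomes of the coin\<close>

text \<open>
  Here \<open>x, x'\<close> are the last two iterates and \<open>h, t\<close> the next one if the coin selects \<open>w = x\<close> or \<open>w = x'\<close>:
  \<open>a = \<parallel>h - x\<parallel>\<close>, \<open>H = \<parallel>h - x'\<parallel>\<close>, \<open>\<tau> = \<parallel>t - x\<parallel>\<close>, \<open>T = \<parallel>t - x'\<parallel>\<close>, \<open>\<delta> = \<parallel>h - t\<parallel>\<close> and \<open>v = \<parallel>x - x'\<parallel>\<close>. The extreme
  case is collinear, with \<open>\<delta>\<close> equal to \<open>u = l (a + T) / (1 + l)\<close>, where the left-hand side is
  \<open>2 l / (1 + l)\<^sup>2\<close> times \<open>(a + T)\<^sup>2\<close>; this factor is at most \<open>5/12\<close> as long as \<open>14 l \<le> 5\<close>.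
\<close>

lemma coupled_distances:
  fixes a T H \<tau> \<delta> v l :: real
  assumes nonneg: "0 \<le> a" "0 \<le> T" "0 \<le> \<delta>" "0 \<le> l" and l: "l\<^sup>2 \<le> 1/8"
    and tri: "a \<le> \<tau> + \<delta>" "\<delta> \<le> \<tau> + a" "T \<le> H + \<delta>" "\<delta> \<le> H + T"
      "v \<le> H + a" "v \<le> T + \<tau>" and \<delta>: "\<delta> \<le> l * v"
  shows "a\<^sup>2 + T\<^sup>2 - \<tau>\<^sup>2 - H\<^sup>2 \<le> 5/12 * (a + T)\<^sup>2"
proof -
  define W where "W = a + T"
  define u where "u = l * W / (1 + l)"
  \<comment> \<open>If \<open>\<delta> > u\<close>, then \<open>v\<close> is so large that \<open>\<tau>\<close> and \<open>H\<close> are at least what they are for \<open>\<delta> = u\<close>; so \<open>d\<close> can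
    take the role of \<open>\<delta>\<close>.\<close>
  define d where "d = min \<delta> u"
  have W: "0 \<le> W" using nonneg W_def by simp
  have l_lt: "14 * l \<le> 5"
  proof (rule ccontr)
    assume "\<not> ?thesis"
    then have "(5/14)\<^sup>2 < l\<^sup>2" by (intro power_strict_mono) auto
    then show False using l by (simp add: power_divide)
  qed
  have u: "u * (1 + l) = l * W" "0 \<le> u" unfolding u_def using nonneg W by auto
  have uW: "2 * u \<le> W"
  proof -
    have "2 * l * W \<le> W * (1 + l)"
      using l_lt W mult_right_mono[of "2 * l" "1 + l" W] by (simp add: mult.commute)
    then have "2 * (l * W) / (1 + l) \<le> W" using nonneg by (simp add: divide_le_eq)
    then show ?thesis by (simp add: u_def)
  qed
  have \<delta>u: "\<delta> \<le> u" if "v \<le> W - u"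
  proof -
    have "\<delta> \<le> l * (W - u)" using \<delta> that nonneg(4) by (meson mult_left_mono order_trans)
    also have "\<dots> = u" using u(1) by (simp add: algebra_simps)
    finally show ?thesis .
  qed
  have bt: "\<bar>a - d\<bar> \<le> \<tau>"
    using tri(1,2,6) \<delta>u nonneg u(2) unfolding d_def W_def by (cases "v \<le> W - u") (auto simp: W_def min_def)
  have bH: "\<bar>T - d\<bar> \<le> H"
    using tri(3,4,5) \<delta>u nonneg u(2) unfolding d_def W_def by (cases "v \<le> W - u") (auto simp: W_def min_def)
  have d: "0 \<le> d" "d \<le> u" using nonneg u unfolding d_def by auto
  have "a\<^sup>2 + T\<^sup>2 - \<tau>\<^sup>2 - H\<^sup>2 \<le> a\<^sup>2 + T\<^sup>2 - (a - d)\<^sup>2 - (T - d)\<^sup>2"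
    using power_mono[OF bt, of 2] power_mono[OF bH, of 2] by simp
  also have "\<dots> = 2 * (d * (W - d))" by (simp add: W_def power2_eq_square algebra_simps)
  also have "\<dots> \<le> 2 * (u * (W - u))"
  proof -
    have "0 \<le> (u - d) * (W - u - d)" using d uW by simp
    then show ?thesis by (simp add: algebra_simps)
  qed
  also have "\<dots> = 2 * l / (1 + l)\<^sup>2 * W\<^sup>2"
  proof -
    have "W - u = W / (1 + l)" unfolding u_def using nonneg by (simp add: field_simps)
    then show ?thesis unfolding u_def by (simp add: power2_eq_square)
  qed
  also have "\<dots> \<le> 5/12 * W\<^sup>2"
  proof (rule mult_right_mono)
    have "5 * (1 + l)\<^sup>2 = 5 + 10 * l + 5 * l\<^sup>2" by (simp add: power2_eq_square algebra_simps)
    then have "2 * l * 12 \<le> 5 * (1 + l)\<^sup>2" using l_lt zero_le_power2[of l] by linarith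
    then show "2 * l / (1 + l)\<^sup>2 \<le> 5/12" using nonneg by (simp add: divide_le_eq)
  qed simp
  finally show ?thesis unfolding W_def .
qed

text \<open>
  If the next iterate did not depend on the coin, then \<open>a = \<tau>\<close> and \<open>H = T\<close>, and the two sides would agree
  without the factor \<open>7/12 = 1 - 5/12\<close>. The defect is \<open>p (1 - p)\<close> times the quantity bounded in
  \<open>coupled_distances\<close>, and \<open>p (1 - p) (a + T)\<^sup>2 \<le> p a\<^sup>2 + (1 - p) T\<^sup>2\<close>.
\<close>

lemma coin_average:
  fixes a T H \<tau> p :: real
  assumes p: "0 \<le> p" "p \<le> 1" and le: "a\<^sup>2 + T\<^sup>2 - \<tau>\<^sup>2 - H\<^sup>2 \<le> 5/12 * (a + T)\<^sup>2"
  shows "7/12 * (p * a\<^sup>2 + (1 - p) * T\<^sup>2)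
    \<le> p * (p * a\<^sup>2 + (1 - p) * H\<^sup>2) + (1 - p) * (p * \<tau>\<^sup>2 + (1 - p) * T\<^sup>2)"
proof -
  have "p * (1 - p) * (a\<^sup>2 + T\<^sup>2 - \<tau>\<^sup>2 - H\<^sup>2) \<le> p * (1 - p) * (5/12 * (a + T)\<^sup>2)"
    using p by (intro mult_left_mono[OF le]) simp
  moreover have "p * (1 - p) * (a + T)\<^sup>2 \<le> p * a\<^sup>2 + (1 - p) * T\<^sup>2"
  proof -
    have "p * a\<^sup>2 + (1 - p) * T\<^sup>2 - p * (1 - p) * (a + T)\<^sup>2 = (p * a - (1 - p) * T)\<^sup>2"
      by (simp add: power2_eq_square algebra_simps)
    then show ?thesis by (metis diff_ge_0_iff_ge zero_le_power2)
  qed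
  moreover have "p * (p * a\<^sup>2 + (1 - p) * H\<^sup>2) + (1 - p) * (p * \<tau>\<^sup>2 + (1 - p) * T\<^sup>2)
    = p * a\<^sup>2 + (1 - p) * T\<^sup>2 - p * (1 - p) * (a\<^sup>2 + T\<^sup>2 - \<tau>\<^sup>2 - H\<^sup>2)"
    by (simp add: power2_eq_square algebra_simps)
  ultimately show ?thesis by simp
qed

section \<open>One step of the algorithm\<close>

lemma subdifferential_add_orthogonal:
  assumes u: "u \<in> subdifferential (\<lambda>z. g z + ind K z) x"
    and n: "\<And>y. y \<in> K \<Longrightarrow> v \<bullet> (y - x) = u \<bullet> (y - x)"
  shows "v \<in> subdifferential (\<lambda>z. g z + ind K z) x"
proof -
  have "g x + ind K x + ereal (v \<bullet> (y - x)) \<le> g y + ind K y" for y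
  proof (cases "y \<in> K")
    case True
    then show ?thesis using u n[OF True] by (simp add: subdifferential_def)
  qed (simp add: ind_def)
  then show ?thesis using u by (simp add: subdifferential_def)
qed

text \<open>
  The problem data and the assumptions that the descent uses; the oracle is only controlled on \<open>dom g\<close>.
  Having \<open>\<gamma> \<ge> 1/2\<close> allows half of \<open>D(x\<^bsub>s+1\<^esub>, x\<^sub>s)\<close> to be spent on the oracle error.
\<close>

locale vi_scheme = mirror_map N K f gf
  for N :: "'a::euclidean_space \<Rightarrow> real" and K f gf +
  fixes g :: "'a \<Rightarrow> ereal" and F :: "'a \<Rightarrow> 'a" and FO :: "nat \<Rightarrow> 'a \<Rightarrow> 'a"
    and Q :: "'a \<Rightarrow> 'a \<Rightarrow> nat pmf" and \<gamma> p \<alpha> L Lbar Lf \<rho> :: real and b :: nat and xstar :: 'a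
  assumes dom_f: "dom_subdiff K f = K"
    and g: "proper_on K g" "ereal_convex_on K g" "lsc_on K g"
    and \<gamma>: "1/2 \<le> \<gamma>" "\<gamma> \<le> 1" and p: "0 \<le> p" "p \<le> 1" and \<alpha>: "0 < \<alpha>" and b: "1 \<le> b"
    and L: "0 \<le> L"
    and Q_finite: "finite (set_pmf (Q x y))"
    and Q_mean: "x \<in> eff_dom K g \<Longrightarrow> y \<in> eff_dom K g \<Longrightarrow> z \<in> eff_dom K g \<Longrightarrow>
      F z = measure_pmf.expectation (Q x y) (\<lambda>\<xi>. FO \<xi> z)"
    and Q_square: "x \<in> eff_dom K g \<Longrightarrow> y \<in> eff_dom K g \<Longrightarrow>
      measure_pmf.expectation (Q x y) (\<lambda>\<xi>. (Nd (FO \<xi> x - FO \<xi> y))\<^sup>2) \<le> Lbar\<^sup>2 * (N (x - y))\<^sup>2"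
    and F_Lipschitz: "x \<in> K \<Longrightarrow> y \<in> K \<Longrightarrow> Nd (F x - F y) \<le> L * N (x - y)"
    and gf_Lipschitz: "x \<in> K \<Longrightarrow> y \<in> K \<Longrightarrow> Nd (gf x - gf y) \<le> Lf * N (x - y)"
    and xstar: "xstar \<in> K" and \<rho>: "0 < \<rho>"
    and weak_Minty: "x \<in> K \<Longrightarrow> w \<in> VI_operator K g F x \<Longrightarrow> - \<rho> * (Nd w)\<^sup>2 \<le> w \<bullet> (x - xstar)"
begin

definition oracle_mean where
  "oracle_mean x w' B = (1 / real b) *\<^sub>R (\<Sum>\<xi>\<leftarrow>B. FO \<xi> x - FO \<xi> w')"

definition next_iterate where
  "next_iterate x x' w w' B =
     prox_step K g f gf \<alpha> (estimator F FO b x w w' B) (mirror_average K f gf \<gamma> x x')"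

lemma estimator_eq: "length B = b \<Longrightarrow> estimator F FO b x w w' B = F w + oracle_mean x w' B"
proof -
  assume len: "length B = b"
  have "(\<Sum>\<xi>\<leftarrow>B. F w + FO \<xi> x - FO \<xi> w') = real (length B) *\<^sub>R F w + (\<Sum>\<xi>\<leftarrow>B. FO \<xi> x - FO \<xi> w')" for B
    by (induction B) (auto simp: algebra_simps)
  then show ?thesis using b len by (simp add: estimator_def oracle_mean_def scaleR_add_right)
qed

lemma prox_step_in:
  assumes "y \<in> K"
  shows "prox_step K g f gf \<alpha> d y \<in> eff_dom K g"
    and "(1/\<alpha>) *\<^sub>R (gf y - gf (prox_step K g f gf \<alpha> d y)) - d
      \<in> subdifferential (\<lambda>z. g z + ind K z) (prox_step K g f gf \<alpha> d y)"
proof -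
  let ?h = "\<lambda>x. ereal \<alpha> * g x + ereal ((\<alpha> *\<^sub>R d) \<bullet> x + D x y)"
  have "\<exists>x. is_arg_min ?h (\<lambda>x. x \<in> K) x"
    using prox_exists[OF g \<alpha> assms, of d] by (fastforce simp: is_arg_min_linorder)
  then have "is_arg_min ?h (\<lambda>x. x \<in> K) (prox_step K g f gf \<alpha> d y)"
    unfolding prox_step_def arg_min_def by (rule someI_ex)
  then have "prox_step K g f gf \<alpha> d y \<in> K"
    "\<And>z. z \<in> K \<Longrightarrow> ?h (prox_step K g f gf \<alpha> d y) \<le> ?h z"
    by (auto simp: is_arg_min_linorder)
  from prox_optimality[OF g(1,2) \<alpha> assms this]
  show "prox_step K g f gf \<alpha> d y \<in> eff_dom K g"
    and "(1/\<alpha>) *\<^sub>R (gf y - gf (prox_step K g f gf \<alpha> d y)) - d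
      \<in> subdifferential (\<lambda>z. g z + ind K z) (prox_step K g f gf \<alpha> d y)" by auto
qed

lemma subdifferential_monotone:
  assumes x: "x \<in> eff_dom K g" and y: "y \<in> eff_dom K g"
    and u: "u \<in> subdifferential (\<lambda>z. g z + ind K z) x"
    and v: "v \<in> subdifferential (\<lambda>z. g z + ind K z) y"
  shows "0 \<le> (u - v) \<bullet> (x - y)"
proof -
  obtain gx gy where "g x = ereal gx" "g y = ereal gy"
    using x y g(1) unfolding eff_dom_def proper_on_def
    by (cases "g x"; cases "g y") auto
  moreover have "x \<in> K" "y \<in> K" using x y by (auto simp: eff_dom_def)
  ultimately have "gx + u \<bullet> (y - x) \<le> gy" "gy + v \<bullet> (x - y) \<le> gx"
    using u v by (auto simp: subdifferential_def ind_def dest: spec[of _ x] spec[of _ y])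
  then show ?thesis by (simp add: inner_diff_left inner_diff_right)
qed

text \<open>
  The gradient of \<open>f\<close> is strongly monotone and the subdifferential of \<open>g + I\<^sub>K\<close> is monotone. This is the
  only estimate that relates the iterates belonging to the two outcomes of a coin.
\<close>

lemma prox_step_Lipschitz:
  assumes y: "y \<in> K"
  shows "N (prox_step K g f gf \<alpha> d y - prox_step K g f gf \<alpha> d' y) \<le> \<alpha> * Nd (d - d')"
proof -
  let ?x = "prox_step K g f gf \<alpha> d y" and ?x' = "prox_step K g f gf \<alpha> d' y"
  note x = prox_step_in[OF y, of d] and x' = prox_step_in[OF y, of d']
  have inK: "?x \<in> K" "?x' \<in> K" using x(1) x'(1) by (auto simp: eff_dom_def)
  have "0 \<le> (((1/\<alpha>) *\<^sub>R (gf y - gf ?x) - d) - ((1/\<alpha>) *\<^sub>R (gf y - gf ?x') - d')) \<bullet> (?x - ?x')"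
    by (rule subdifferential_monotone[OF x(1) x'(1) x(2) x'(2)])
  also have "((1/\<alpha>) *\<^sub>R (gf y - gf ?x) - d) - ((1/\<alpha>) *\<^sub>R (gf y - gf ?x') - d')
      = (d' - d) - (1/\<alpha>) *\<^sub>R (gf ?x - gf ?x')" by (simp add: algebra_simps)
  finally have "(1/\<alpha>) * ((gf ?x - gf ?x') \<bullet> (?x - ?x')) \<le> (d' - d) \<bullet> (?x - ?x')"
    by (simp add: inner_diff_left)
  then have "(gf ?x - gf ?x') \<bullet> (?x - ?x') \<le> \<alpha> * ((d' - d) \<bullet> (?x - ?x'))"
    using \<alpha> by (simp add: field_simps)
  also have "\<dots> \<le> \<alpha> * (Nd (d - d') * N (?x - ?x'))"
    using inner_le_dual[of "d' - d" "?x - ?x'"] \<alpha> by (simp add: Nd_commute)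
  finally have "N (?x - ?x') * N (?x - ?x') \<le> \<alpha> * Nd (d - d') * N (?x - ?x')"
    using gradient_strongly_monotone[OF inK] by (simp add: power2_eq_square)
  then show ?thesis
    using N_nonneg[of "?x - ?x'"] \<alpha> by (cases "N (?x - ?x') = 0") (auto simp: mult_le_cancel_right)
qed

definition residual where "residual x = enn2real (dual_dist0 N (VI_operator K g F x))"

lemma residual_le: "w \<in> VI_operator K g F x \<Longrightarrow> residual x \<le> Nd w"
  unfolding residual_def dual_dist0_def
  by (intro enn2real_leI INF_lower) auto

lemma dual_dist0_residual:
  assumes "w \<in> VI_operator K g F x"
  shows "dual_dist0 N (VI_operator K g F x) = ennreal (residual x)"
proof -
  have "dual_dist0 N (VI_operator K g F x) \<le> ennreal (Nd w)"
    unfolding dual_dist0_def using assms by (rule INF_lower)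
  then show ?thesis unfolding residual_def by (simp add: top.not_eq_extremum le_less_trans)
qed

text \<open>
  The inner product telescopes: the step that produced \<open>x\<close> used \<open>F(w')\<close> in the place of \<open>F(x)\<close>, and the
  next estimator, with mean \<open>F(w) + F(x) - F(w')\<close>, corrects this error on average.
\<close>

definition energy where
  "energy x x' w' = D xstar x + (1 - \<gamma>) * D xstar x' - \<alpha> * ((F x - F w') \<bullet> (x - xstar))"

text \<open>
  The last component of a state is \<open>w\<^bsub>s-1\<^esub>\<close>; the coin for \<open>w\<^sub>s\<close> is drawn within the step.
\<close>

definition admissible where
  "admissible x x' w' \<longleftrightarrow> x \<in> K \<and> x' \<in> K \<and> w' \<in> K \<and> \<gamma> *\<^sub>R gf x + (1 - \<gamma>) *\<^sub>R gf x' \<in> gf ` K"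

lemma mirror_average:
  assumes "admissible x x' w'"
  shows "mirror_average K f gf \<gamma> x x' \<in> K"
    and "gf (mirror_average K f gf \<gamma> x x') = \<gamma> *\<^sub>R gf x + (1 - \<gamma>) *\<^sub>R gf x'"
  using assms unfolding admissible_def mirror_average_def dom_f
  by (auto intro: inv_into_into f_inv_into_f)

lemma next_iterate_in: "admissible x x' w' \<Longrightarrow> next_iterate x x' w w' B \<in> eff_dom K g"
  unfolding next_iterate_def using mirror_average by (intro prox_step_in)

text \<open>
  The optimality condition of the proximal step, with the oracle mean replaced by any vector that acts
  on \<open>K\<close> in the same way.
\<close>

lemma next_iterate_residual:
  fixes x x' w w' e :: 'a and B :: "nat list"
  assumes adm: "admissible x x' w'" and len: "length B = b"
    and e: "\<And>k k'. k \<in> K \<Longrightarrow> k' \<in> K \<Longrightarrow> e \<bullet> (k - k') = oracle_mean x w' B \<bullet> (k - k')"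
  defines "xn \<equiv> next_iterate x x' w w' B"
  shows "(F xn - F w) + (- e) + (1/\<alpha>) *\<^sub>R (\<gamma> *\<^sub>R gf x + (1 - \<gamma>) *\<^sub>R gf x' - gf xn) \<in> VI_operator K g F xn"
proof -
  let ?y = "mirror_average K f gf \<gamma> x x'"
  note y = mirror_average[OF adm]
  have xnK: "xn \<in> K" using next_iterate_in[OF adm] by (simp add: xn_def eff_dom_def)
  have "(1/\<alpha>) *\<^sub>R (gf ?y - gf xn) - (F w + oracle_mean x w' B) \<in> subdifferential (\<lambda>z. g z + ind K z) xn"
    using prox_step_in(2)[OF y(1), of "F w + oracle_mean x w' B"]
    by (simp add: xn_def next_iterate_def estimator_eq[OF len])
  then have "(1/\<alpha>) *\<^sub>R (gf ?y - gf xn) - (F w + e) \<in> subdifferential (\<lambda>z. g z + ind K z) xn"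
    by (rule subdifferential_add_orthogonal)
      (use e xnK in \<open>simp add: inner_diff_left inner_add_left\<close>)
  then show ?thesis
    unfolding VI_operator_def y(2)[symmetric] by (rule rev_image_eqI) (simp add: algebra_simps)
qed

text \<open>
  The weak Minty inequality for the element above, expanded with the three-point identity. Half of
  \<open>D(x\<^bsub>s+1\<^esub>, x\<^sub>s)\<close> stays next to the oracle mean, for \<open>batch_Young\<close>; the rest of the Bregman distances is
  bounded below by squared norms and pays for the gradient part of the residual. With \<open>r\<close> in the
  place of \<open>\<rho>\<close> in all error terms, a multiple of the squared residual remains on the left.
\<close>

lemma energy_next:
  fixes x x' w w' e :: 'a and B :: "nat list" and r :: real
  assumes adm: "admissible x x' w'" and wK: "w \<in> K" and len: "length B = b"
    and e: "\<And>k k'. k \<in> K \<Longrightarrow> k' \<in> K \<Longrightarrow> e \<bullet> (k - k') = oracle_mean x w' B \<bullet> (k - k')"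
    and r: "\<rho> \<le> r"
  defines "xn \<equiv> next_iterate x x' w w' B" and "\<kappa> \<equiv> 8 * r * Lf\<^sup>2 / \<alpha>"
  shows "\<alpha> * (r - \<rho>) * (residual xn)\<^sup>2 + energy xn x w \<le> energy x x' w'
    + \<alpha> * ((F x - F w' - oracle_mean x w' B) \<bullet> (x - xstar))
    + (- \<alpha> * (oracle_mean x w' B \<bullet> (xn - x)) - D xn x / 2)
    + 8/3 * \<alpha> * r * (Nd e)\<^sup>2
    + (8/3 * \<alpha> * r * L\<^sup>2 * (N (xn - w))\<^sup>2 - (\<gamma> * (1 - \<kappa>) - 1/2) / 2 * (N (xn - x))\<^sup>2
       - (1 - \<gamma>) * (1 - \<kappa>) / 2 * (N (xn - x'))\<^sup>2)"
proof -
  define E where "E = oracle_mean x w' B"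
  define h where "h = \<gamma> *\<^sub>R gf x + (1 - \<gamma>) *\<^sub>R gf x' - gf xn"
  define wt where "wt = (F xn - F w) + (- e) + (1/\<alpha>) *\<^sub>R h"
  have K': "x \<in> K" "x' \<in> K" "w' \<in> K" using adm by (auto simp: admissible_def)
  have xnK: "xn \<in> K" using next_iterate_in[OF adm] by (simp add: xn_def eff_dom_def)
  have wt: "wt \<in> VI_operator K g F xn"
    using next_iterate_residual[OF adm len e, of w] by (simp add: wt_def h_def xn_def)
  have r0: "0 < r" using r \<rho> by simp
  have h_le: "(Nd h)\<^sup>2 \<le> Lf\<^sup>2 * (\<gamma> * (N (xn - x))\<^sup>2 + (1 - \<gamma>) * (N (xn - x'))\<^sup>2)"
  proof -
    have "h = \<gamma> *\<^sub>R (gf x - gf xn) + (1 - \<gamma>) *\<^sub>R (gf x' - gf xn)" unfolding h_def by (simp add: algebra_simps)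
    then have "Nd h \<le> \<gamma> * Nd (gf x - gf xn) + (1 - \<gamma>) * Nd (gf x' - gf xn)"
      using Nd_add[of "\<gamma> *\<^sub>R (gf x - gf xn)" "(1 - \<gamma>) *\<^sub>R (gf x' - gf xn)"] \<gamma> by (simp add: Nd_scale)
    also have "\<dots> \<le> \<gamma> * (Lf * N (xn - x)) + (1 - \<gamma>) * (Lf * N (xn - x'))"
      using gf_Lipschitz[OF K'(1) xnK] gf_Lipschitz[OF K'(2) xnK] \<gamma>
      by (intro add_mono mult_left_mono) (auto simp: N_commute)
    finally have "(Nd h)\<^sup>2 \<le> (\<gamma> * (Lf * N (xn - x)) + (1 - \<gamma>) * (Lf * N (xn - x')))\<^sup>2"
      by (intro power_mono) auto
    also have "\<dots> \<le> \<gamma> * (Lf * N (xn - x))\<^sup>2 + (1 - \<gamma>) * (Lf * N (xn - x'))\<^sup>2"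
    proof -
      have "\<gamma> * s\<^sup>2 + (1 - \<gamma>) * t\<^sup>2 - (\<gamma> * s + (1 - \<gamma>) * t)\<^sup>2 = \<gamma> * (1 - \<gamma>) * (s - t)\<^sup>2" for s t :: real
        by (simp add: power2_eq_square algebra_simps)
      moreover have "0 \<le> \<gamma> * (1 - \<gamma>) * (s - t)\<^sup>2" for s t :: real using \<gamma> by simp
      ultimately show ?thesis by (metis diff_ge_0_iff_ge)
    qed
    finally show ?thesis by (simp add: power_mult_distrib algebra_simps)
  qed
  have wt_le: "\<alpha> * r * (Nd wt)\<^sup>2 \<le> 8/3 * \<alpha> * r * L\<^sup>2 * (N (xn - w))\<^sup>2 + 8/3 * \<alpha> * r * (Nd e)\<^sup>2
      + \<kappa> / 2 * (\<gamma> * (N (xn - x))\<^sup>2 + (1 - \<gamma>) * (N (xn - x'))\<^sup>2)"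
  proof -
    have "(Nd (F xn - F w))\<^sup>2 \<le> (L * N (xn - w))\<^sup>2" using F_Lipschitz[OF xnK wK] by (intro power_mono) auto
    moreover have "(Nd ((1/\<alpha>) *\<^sub>R h))\<^sup>2 = (Nd h)\<^sup>2 / \<alpha>\<^sup>2" using \<alpha> by (simp add: Nd_scale power_divide)
    moreover have "(Nd h)\<^sup>2 / \<alpha>\<^sup>2 \<le> Lf\<^sup>2 * (\<gamma> * (N (xn - x))\<^sup>2 + (1 - \<gamma>) * (N (xn - x'))\<^sup>2) / \<alpha>\<^sup>2"
      using h_le by (intro divide_right_mono) auto
    ultimately have "(Nd wt)\<^sup>2 \<le> 8/3 * (L * N (xn - w))\<^sup>2 + 8/3 * (Nd e)\<^sup>2
        + 4 * (Lf\<^sup>2 * (\<gamma> * (N (xn - x))\<^sup>2 + (1 - \<gamma>) * (N (xn - x'))\<^sup>2) / \<alpha>\<^sup>2)"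
      using Nd_sum_sq3[of "F xn - F w" "- e" "(1/\<alpha>) *\<^sub>R h"] by (simp add: wt_def Nd_minus)
    then have "\<alpha> * r * (Nd wt)\<^sup>2 \<le> \<alpha> * r * (8/3 * (L * N (xn - w))\<^sup>2 + 8/3 * (Nd e)\<^sup>2
        + 4 * (Lf\<^sup>2 * (\<gamma> * (N (xn - x))\<^sup>2 + (1 - \<gamma>) * (N (xn - x'))\<^sup>2) / \<alpha>\<^sup>2))"
      using \<alpha> r0 by (intro mult_left_mono) auto
    also have "\<dots> = 8/3 * \<alpha> * r * L\<^sup>2 * (N (xn - w))\<^sup>2 + 8/3 * \<alpha> * r * (Nd e)\<^sup>2
      + \<kappa> / 2 * (\<gamma> * (N (xn - x))\<^sup>2 + (1 - \<gamma>) * (N (xn - x'))\<^sup>2)"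
      using \<alpha> unfolding \<kappa>_def by (simp add: field_simps power_mult_distrib power2_eq_square)
    finally show ?thesis .
  qed
  have res: "\<alpha> * (r - \<rho>) * (residual xn)\<^sup>2 \<le> \<alpha> * r * (Nd wt)\<^sup>2 + \<alpha> * (wt \<bullet> (xn - xstar))"
  proof -
    have "0 \<le> residual xn" by (simp add: residual_def)
    then have "(residual xn)\<^sup>2 \<le> (Nd wt)\<^sup>2" using residual_le[OF wt] by (rule power_mono[rotated])
    then have "\<alpha> * (r - \<rho>) * (residual xn)\<^sup>2 \<le> \<alpha> * (r - \<rho>) * (Nd wt)\<^sup>2"
      using \<alpha> r by (intro mult_left_mono) auto
    moreover have "\<alpha> * (- \<rho> * (Nd wt)\<^sup>2) \<le> \<alpha> * (wt \<bullet> (xn - xstar))"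
      using weak_Minty[OF xnK wt] \<alpha> by (intro mult_left_mono) auto
    ultimately show ?thesis by (simp add: algebra_simps)
  qed
  have ip: "\<alpha> * (wt \<bullet> (xn - xstar)) = \<alpha> * ((F xn - F w) \<bullet> (xn - xstar)) - \<alpha> * (E \<bullet> (xn - xstar))
      + h \<bullet> (xn - xstar)"
    using \<alpha> e[OF xnK xstar]
    by (simp add: wt_def E_def inner_add_left inner_diff_left[of "F xn - F w"] distrib_left
        right_diff_distrib)
  have hip: "h \<bullet> (xn - xstar) = \<gamma> * (D xstar x - D xstar xn - D xn x)
      + (1 - \<gamma>) * (D xstar x' - D xstar xn - D xn x')"
    unfolding h_def bregman_def by (simp add: inner_add_left inner_diff_left inner_diff_right algebra_simps)
  have split: "E \<bullet> (xn - xstar) = E \<bullet> (xn - x) + E \<bullet> (x - xstar)" by (simp add: inner_diff_right)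
  have quad: "(\<gamma> - 1/2) * ((N (xn - x))\<^sup>2 / 2) \<le> (\<gamma> - 1/2) * D xn x"
      "(1 - \<gamma>) * ((N (xn - x'))\<^sup>2 / 2) \<le> (1 - \<gamma>) * D xn x'"
    by (rule mult_left_mono[OF strong[OF xnK K'(1)]], use \<gamma> in simp)
      (rule mult_left_mono[OF strong[OF xnK K'(2)]], use \<gamma> in simp)
  have expand:
    "\<kappa> / 2 * (\<gamma> * (N (xn - x))\<^sup>2 + (1 - \<gamma>) * (N (xn - x'))\<^sup>2)
      - (\<gamma> - 1/2) * ((N (xn - x))\<^sup>2 / 2) - (1 - \<gamma>) * ((N (xn - x'))\<^sup>2 / 2)
    = - ((\<gamma> * (1 - \<kappa>) - 1/2) / 2 * (N (xn - x))\<^sup>2) - (1 - \<gamma>) * (1 - \<kappa>) / 2 * (N (xn - x'))\<^sup>2"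
    by (simp add: field_simps)
  have sampled: "\<alpha> * ((F x - F w' - E) \<bullet> (x - xstar)) = \<alpha> * ((F x - F w') \<bullet> (x - xstar)) - \<alpha> * (E \<bullet> (x - xstar))"
    "\<alpha> * (E \<bullet> (xn - xstar)) = \<alpha> * (E \<bullet> (xn - x)) + \<alpha> * (E \<bullet> (x - xstar))"
    by (simp_all add: inner_diff_left[of "F x - F w'"] split right_diff_distrib distrib_left)
  have bregman: "\<gamma> * (D xstar x - D xstar xn - D xn x) + (1 - \<gamma>) * (D xstar x' - D xstar xn - D xn x')
      = D xstar x - (1 - \<gamma>) * D xstar x + (1 - \<gamma>) * D xstar x' - D xstar xn
        - D xn x / 2 - (\<gamma> - 1/2) * D xn x - (1 - \<gamma>) * D xn x'"
    by (simp add: algebra_simps)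
  show ?thesis
    using res wt_le quad expand sampled bregman unfolding ip hip energy_def E_def[symmetric] by linarith
qed

end

section \<open>Expectation over the batch\<close>

context vi_scheme
begin

text \<open>
  The three effects of sampling: the oracle is unbiased, its correlation with the next iterate costs
  \<open>V\<close>, and its size in the residual costs \<open>L\<^sub>f\<^sup>2 V\<close>. In \<open>V\<close> the mean contributes \<open>L\<^sup>2\<close> and the fluctuation
  \<open>Lbar\<^sup>2 / b\<close>.
\<close>

lemma oracle_mean_batch:
  fixes k :: "nat list \<Rightarrow> 'a" and x w' :: 'a
  assumes x: "x \<in> eff_dom K g" and w': "w' \<in> eff_dom K g"
  defines "R \<equiv> replicate_pmf b (Q x w')"
    and "V \<equiv> (\<alpha>\<^sup>2 * L\<^sup>2 + \<alpha>\<^sup>2 * Lbar\<^sup>2 / real b) * (N (x - w'))\<^sup>2"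
  shows "measure_pmf.expectation R (\<lambda>B. \<alpha> * ((F x - F w' - oracle_mean x w' B) \<bullet> y)) = 0"
    and "(\<And>B. B \<in> set_pmf R \<Longrightarrow> k B \<in> K) \<Longrightarrow>
      measure_pmf.expectation R (\<lambda>B. - \<alpha> * (oracle_mean x w' B \<bullet> (k B - x)) - D (k B) x / 2) \<le> V"
    and "\<exists>e. (\<forall>B\<in>set_pmf R. \<forall>v\<in>K. \<forall>v'\<in>K. e B \<bullet> (v - v') = oracle_mean x w' B \<bullet> (v - v')) \<and>
          \<alpha>\<^sup>2 * measure_pmf.expectation R (\<lambda>B. (Nd (e B))\<^sup>2) \<le> Lf\<^sup>2 * V"
proof -
  let ?Q = "Q x w'" and ?n = "N (x - w')"
  have fin: "finite (set_pmf ?Q)" by (rule Q_finite)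
  note int = integrable_measure_pmf_finite[OF fin]
  have finR: "finite (set_pmf R)" unfolding R_def by (rule finite_replicate_pmf[OF fin])
  note intR = integrable_measure_pmf_finite[OF finR]
  have b0: "real b > 0" using b by simp
  have inK: "x \<in> K" "w' \<in> K" using x w' by (auto simp: eff_dom_def)
  define X where "X \<xi> = FO \<xi> x - FO \<xi> w'" for \<xi>
  have mean: "measure_pmf.expectation ?Q X = F x - F w'"
    unfolding X_def Q_mean[OF x w' x] Q_mean[OF x w' w']
    by (rule Bochner_Integration.integral_diff[OF int int])
  have square: "measure_pmf.expectation ?Q (\<lambda>\<xi>. (Nd (X \<xi>))\<^sup>2) \<le> Lbar\<^sup>2 * ?n\<^sup>2"
    unfolding X_def by (rule Q_square[OF x w'])
  have mean_le: "(Nd (F x - F w'))\<^sup>2 \<le> L\<^sup>2 * ?n\<^sup>2"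
    using F_Lipschitz[OF inK] by (simp flip: power_mult_distrib add: power_mono)
  have mean_scale: "measure_pmf.expectation ?Q (\<lambda>\<xi>. c *\<^sub>R X \<xi>) = c *\<^sub>R (F x - F w')" for c
    by (simp add: mean)
  have square_scale: "measure_pmf.expectation ?Q (\<lambda>\<xi>. (Nd (c *\<^sub>R X \<xi>))\<^sup>2) \<le> c\<^sup>2 * (Lbar\<^sup>2 * ?n\<^sup>2)" for c
    using mult_left_mono[OF square, of "c\<^sup>2"] by (simp add: Nd_scale power_mult_distrib)
  have sum_scale: "(\<Sum>\<xi>\<leftarrow>B. (c / real b) *\<^sub>R X \<xi>) = c *\<^sub>R oracle_mean x w' B" for c B
    unfolding oracle_mean_def X_def by (induction B) (auto simp: scaleR_add_right)
  have total: "measure_pmf.expectation R (\<lambda>B. oracle_mean x w' B \<bullet> y) = (F x - F w') \<bullet> y" for y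
    using expectation_sum_list_replicate[OF fin, of b "\<lambda>\<xi>. (1 / real b) *\<^sub>R X \<xi>" y] b0
    unfolding R_def sum_scale mean_scale by simp
  show "measure_pmf.expectation R (\<lambda>B. \<alpha> * ((F x - F w' - oracle_mean x w' B) \<bullet> y)) = 0"
    unfolding inner_diff_left[of "F x - F w'"]
    by (simp add: total Bochner_Integration.integral_diff[OF intR intR])
  show "measure_pmf.expectation R (\<lambda>B. - \<alpha> * (oracle_mean x w' B \<bullet> (k B - x)) - D (k B) x / 2) \<le> V"
    if k: "\<And>B. B \<in> set_pmf R \<Longrightarrow> k B \<in> K"
  proof -
    let ?c = "- 2 * \<alpha>"
    have "measure_pmf.expectation R (\<lambda>B. - \<alpha> * (oracle_mean x w' B \<bullet> (k B - x)) - D (k B) x / 2)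
       = measure_pmf.expectation R (\<lambda>B. 1/2 * ((\<Sum>\<xi>\<leftarrow>B. (?c / real b) *\<^sub>R X \<xi>) \<bullet> (k B - x) - D (k B) x))"
      unfolding sum_scale by (simp add: algebra_simps)
    also have "\<dots> = 1/2 * measure_pmf.expectation R
        (\<lambda>B. (\<Sum>\<xi>\<leftarrow>B. (?c / real b) *\<^sub>R X \<xi>) \<bullet> (k B - x) - D (k B) x)"
      by (rule integral_mult_right_zero)
    also have "\<dots> \<le> 1/2 * ((Nd (real b *\<^sub>R ((?c / real b) *\<^sub>R (F x - F w'))))\<^sup>2 / 2
        + real b * ((?c / real b)\<^sup>2 * (Lbar\<^sup>2 * ?n\<^sup>2)) / 2)"
    proof -
      have "measure_pmf.expectation (replicate_pmf b ?Q)
          (\<lambda>B. (\<Sum>\<xi>\<leftarrow>B. (?c / real b) *\<^sub>R X \<xi>) \<bullet> (k B - x) - D (k B) x)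
        \<le> (Nd (real b *\<^sub>R measure_pmf.expectation ?Q (\<lambda>\<xi>. (?c / real b) *\<^sub>R X \<xi>)))\<^sup>2 / 2
          + real b * measure_pmf.expectation ?Q (\<lambda>\<xi>. (Nd ((?c / real b) *\<^sub>R X \<xi>))\<^sup>2) / 2"
        by (rule batch_Young[OF inK(1) fin]) (rule k[unfolded R_def])
      also have "\<dots> \<le> (Nd (real b *\<^sub>R ((?c / real b) *\<^sub>R (F x - F w'))))\<^sup>2 / 2
        + real b * ((?c / real b)\<^sup>2 * (Lbar\<^sup>2 * ?n\<^sup>2)) / 2"
        unfolding mean_scale
        by (intro add_left_mono divide_right_mono mult_left_mono square_scale) auto
      finally show ?thesis unfolding R_def by (intro mult_left_mono) auto
    qed
    also have "\<dots> = \<alpha>\<^sup>2 * (Nd (F x - F w'))\<^sup>2 + \<alpha>\<^sup>2 * Lbar\<^sup>2 / real b * ?n\<^sup>2"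
    proof -
      have "(Nd (real b *\<^sub>R ((?c / real b) *\<^sub>R (F x - F w'))))\<^sup>2 = 4 * \<alpha>\<^sup>2 * (Nd (F x - F w'))\<^sup>2"
        unfolding Nd_scale using b0 \<alpha> by (simp add: power_mult_distrib abs_mult)
      moreover have "real b * ((?c / real b)\<^sup>2 * (Lbar\<^sup>2 * ?n\<^sup>2)) = 4 * (\<alpha>\<^sup>2 * Lbar\<^sup>2 / real b * ?n\<^sup>2)"
        using b0 by (simp add: power2_eq_square)
      ultimately show ?thesis by simp
    qed
    also have "\<dots> \<le> \<alpha>\<^sup>2 * (L\<^sup>2 * ?n\<^sup>2) + \<alpha>\<^sup>2 * Lbar\<^sup>2 / real b * ?n\<^sup>2"
      using mean_le by (intro add_right_mono mult_left_mono) auto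
    finally show ?thesis by (simp add: V_def algebra_simps)
  qed
  obtain e where e: "\<And>B v v'. B \<in> set_pmf R \<Longrightarrow> v \<in> K \<Longrightarrow> v' \<in> K \<Longrightarrow>
        e B \<bullet> (v - v') = (\<Sum>\<xi>\<leftarrow>B. (1 / real b) *\<^sub>R X \<xi>) \<bullet> (v - v')"
    and e_sq: "measure_pmf.expectation R (\<lambda>B. (Nd (e B))\<^sup>2)
      \<le> Lf\<^sup>2 * ((Nd (real b *\<^sub>R ((1 / real b) *\<^sub>R (F x - F w'))))\<^sup>2
               + real b * measure_pmf.expectation ?Q (\<lambda>\<xi>. (Nd ((1 / real b) *\<^sub>R X \<xi>))\<^sup>2))"
    using batch_representative[OF fin gf_Lipschitz, of b "\<lambda>\<xi>. (1 / real b) *\<^sub>R X \<xi>"]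
    unfolding R_def mean_scale by blast
  have "measure_pmf.expectation R (\<lambda>B. (Nd (e B))\<^sup>2)
      \<le> Lf\<^sup>2 * (L\<^sup>2 * ?n\<^sup>2 + real b * ((1 / real b)\<^sup>2 * (Lbar\<^sup>2 * ?n\<^sup>2)))"
    using mean_le b0 by (intro order_trans[OF e_sq] mult_left_mono add_mono square_scale) auto
  then have "\<alpha>\<^sup>2 * measure_pmf.expectation R (\<lambda>B. (Nd (e B))\<^sup>2)
      \<le> \<alpha>\<^sup>2 * (Lf\<^sup>2 * (L\<^sup>2 * ?n\<^sup>2 + real b * ((1 / real b)\<^sup>2 * (Lbar\<^sup>2 * ?n\<^sup>2))))"
    by (intro mult_left_mono) auto
  also have "\<dots> = Lf\<^sup>2 * V" unfolding V_def using b0 by (simp add: field_simps power2_eq_square)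
  finally show "\<exists>e. (\<forall>B\<in>set_pmf R. \<forall>v\<in>K. \<forall>v'\<in>K. e B \<bullet> (v - v') = oracle_mean x w' B \<bullet> (v - v')) \<and>
          \<alpha>\<^sup>2 * measure_pmf.expectation R (\<lambda>B. (Nd (e B))\<^sup>2) \<le> Lf\<^sup>2 * V"
    using e sum_scale[of 1] by (intro exI[of _ e]) simp
qed

text \<open>
  Both costs of sampling in the next step are multiples of the squared distance from \<open>x\<close> to \<open>w'\<close>; the
  coefficient is exactly their total.
\<close>

definition weight where
  "weight r = (1 + 8 * r * Lf\<^sup>2 / \<alpha> / 3) * (\<alpha>\<^sup>2 * L\<^sup>2 + \<alpha>\<^sup>2 * Lbar\<^sup>2 / real b)"

definition lyapunov where
  "lyapunov r x x' w' = energy x x' w' + weight r * (N (x - w'))\<^sup>2"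

definition slack where
  "slack r a1 a2 a3 = (weight r + 8/3 * \<alpha> * r * L\<^sup>2) * a1\<^sup>2
     - (\<gamma> * (1 - 8 * r * Lf\<^sup>2 / \<alpha>) - 1/2) / 2 * a2\<^sup>2 - (1 - \<gamma>) * (1 - 8 * r * Lf\<^sup>2 / \<alpha>) / 2 * a3\<^sup>2"

text \<open>
  By the Lipschitz bound and Young's inequality, the inner product is absorbed by \<open>D(x\<^sup>*, x)\<close> and half
  of \<open>\<alpha>\<^sup>2 L\<^sup>2\<close> times the squared distance from \<open>x\<close> to \<open>w'\<close>.
\<close>

lemma lyapunov_nonneg:
  assumes adm: "admissible x x' w'" and r: "0 \<le> r"
  shows "0 \<le> lyapunov r x x' w'"
proof -
  have inK: "x \<in> K" "x' \<in> K" "w' \<in> K" using adm by (auto simp: admissible_def)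
  have "\<alpha> * ((F x - F w') \<bullet> (x - xstar)) \<le> \<alpha> * (L * N (x - w') * N (x - xstar))"
  proof (rule mult_left_mono)
    show "(F x - F w') \<bullet> (x - xstar) \<le> L * N (x - w') * N (x - xstar)"
      using inner_le_dual[of "F x - F w'" "x - xstar"] F_Lipschitz[OF inK(1,3)]
      by (meson N_nonneg mult_right_mono order_trans)
  qed (use \<alpha> in simp)
  also have "\<dots> \<le> (\<alpha> * L * N (x - w'))\<^sup>2 / 2 + (N (x - xstar))\<^sup>2 / 2"
    using sum_squares_bound[of "\<alpha> * L * N (x - w')" "N (x - xstar)"] by simp
  also have "(N (x - xstar))\<^sup>2 / 2 \<le> D xstar x" using strong[OF xstar inK(1)] by (simp add: N_commute)
  also have "(\<alpha> * L * N (x - w'))\<^sup>2 / 2 \<le> weight r * (N (x - w'))\<^sup>2"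
  proof -
    have "1 * (\<alpha>\<^sup>2 * L\<^sup>2 + 0) \<le> weight r"
      unfolding weight_def using \<alpha> r b by (intro mult_mono add_mono) auto
    then have "\<alpha>\<^sup>2 * L\<^sup>2 * (N (x - w'))\<^sup>2 \<le> weight r * (N (x - w'))\<^sup>2" by (intro mult_right_mono) auto
    moreover have "0 \<le> \<alpha>\<^sup>2 * L\<^sup>2 * (N (x - w'))\<^sup>2" by simp
    moreover have "(\<alpha> * L * N (x - w'))\<^sup>2 = \<alpha>\<^sup>2 * L\<^sup>2 * (N (x - w'))\<^sup>2" by (simp add: power_mult_distrib)
    ultimately show ?thesis by linarith
  qed
  finally have "\<alpha> * ((F x - F w') \<bullet> (x - xstar)) \<le> weight r * (N (x - w'))\<^sup>2 + D xstar x" by simp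
  moreover have "0 \<le> (1 - \<gamma>) * D xstar x'" using bregman_nonneg[OF xstar inK(2)] \<gamma> by simp
  ultimately show ?thesis unfolding lyapunov_def energy_def by simp
qed

text \<open>
  For fixed \<open>w\<close> the batch does not depend on the state beyond \<open>x\<close> and \<open>w'\<close>, so \<open>energy_next\<close> can be
  averaged over it. The three sampling terms add up to \<open>weight r\<close> times the squared distance from \<open>x\<close> to
  \<open>w'\<close>, which turns the old energy into the old potential; the new potential brings the same term with
  the distance from the next iterate to \<open>w\<close>, collected in \<open>slack\<close>.
\<close>

lemma lyapunov_batch:
  assumes adm: "admissible x x' w'" and x: "x \<in> eff_dom K g" and w': "w' \<in> eff_dom K g"
    and w: "w \<in> K" and r: "\<rho> \<le> r"
  shows "measure_pmf.expectation (replicate_pmf b (Q x w'))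
      (\<lambda>B. \<alpha> * (r - \<rho>) * (residual (next_iterate x x' w w' B))\<^sup>2
          + lyapunov r (next_iterate x x' w w' B) x w)
    \<le> lyapunov r x x' w' + measure_pmf.expectation (replicate_pmf b (Q x w'))
      (\<lambda>B. slack r (N (next_iterate x x' w w' B - w)) (N (next_iterate x x' w w' B - x))
          (N (next_iterate x x' w w' B - x')))"
proof -
  let ?R = "replicate_pmf b (Q x w')" and ?xn = "next_iterate x x' w w'"
  let ?V = "(\<alpha>\<^sup>2 * L\<^sup>2 + \<alpha>\<^sup>2 * Lbar\<^sup>2 / real b) * (N (x - w'))\<^sup>2"
  have finR: "finite (set_pmf ?R)" by (intro finite_replicate_pmf Q_finite)
  note int = integrable_measure_pmf_finite[OF finR]
  have xnK: "?xn B \<in> K" for B using next_iterate_in[OF adm] by (simp add: eff_dom_def)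
  have r0: "0 < r" using r \<rho> by simp
  obtain e where e: "\<And>B v v'. B \<in> set_pmf ?R \<Longrightarrow> v \<in> K \<Longrightarrow> v' \<in> K \<Longrightarrow>
        e B \<bullet> (v - v') = oracle_mean x w' B \<bullet> (v - v')"
    and e_sq: "\<alpha>\<^sup>2 * measure_pmf.expectation ?R (\<lambda>B. (Nd (e B))\<^sup>2) \<le> Lf\<^sup>2 * ?V"
    using oracle_mean_batch(3)[OF x w'] by blast
  define Y1 where "Y1 B = \<alpha> * ((F x - F w' - oracle_mean x w' B) \<bullet> (x - xstar))" for B
  define Y2 where "Y2 B = - \<alpha> * (oracle_mean x w' B \<bullet> (?xn B - x)) - D (?xn B) x / 2" for B
  define Y3 where "Y3 B = 8/3 * \<alpha> * r * (Nd (e B))\<^sup>2" for B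
  define Y4 where "Y4 B = slack r (N (?xn B - w)) (N (?xn B - x)) (N (?xn B - x'))" for B
  have "measure_pmf.expectation ?R (\<lambda>B. \<alpha> * (r - \<rho>) * (residual (?xn B))\<^sup>2 + lyapunov r (?xn B) x w)
      \<le> measure_pmf.expectation ?R (\<lambda>B. energy x x' w' + (Y1 B + (Y2 B + (Y3 B + Y4 B))))"
  proof (rule expectation_mono_finite[OF finR])
    fix B assume B: "B \<in> set_pmf ?R"
    then have len: "length B = b" by (simp add: set_replicate_pmf)
    show "\<alpha> * (r - \<rho>) * (residual (?xn B))\<^sup>2 + lyapunov r (?xn B) x w
        \<le> energy x x' w' + (Y1 B + (Y2 B + (Y3 B + Y4 B)))"
      using energy_next[OF adm w len e[OF B] r]
      unfolding Y1_def Y2_def Y3_def Y4_def slack_def lyapunov_def by (simp add: algebra_simps)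
  qed
  also have "\<dots> = energy x x' w' + (measure_pmf.expectation ?R Y1 + (measure_pmf.expectation ?R Y2
      + (measure_pmf.expectation ?R Y3 + measure_pmf.expectation ?R Y4)))"
    by (simp add: Bochner_Integration.integral_add[OF int int])
  also have "measure_pmf.expectation ?R Y1 = 0"
    unfolding Y1_def by (rule oracle_mean_batch(1)[OF x w'])
  also have "measure_pmf.expectation ?R Y2 \<le> ?V"
    unfolding Y2_def by (rule oracle_mean_batch(2)[OF x w' xnK])
  also have "measure_pmf.expectation ?R Y3 \<le> 8 * r * Lf\<^sup>2 / \<alpha> / 3 * ?V"
  proof -
    have "measure_pmf.expectation ?R Y3
        = 8/3 * r / \<alpha> * (\<alpha>\<^sup>2 * measure_pmf.expectation ?R (\<lambda>B. (Nd (e B))\<^sup>2))"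
      unfolding Y3_def using \<alpha> by (simp add: power2_eq_square)
    also have "\<dots> \<le> 8/3 * r / \<alpha> * (Lf\<^sup>2 * ?V)"
      using e_sq \<alpha> r0 by (intro mult_left_mono) auto
    finally show ?thesis by (simp add: field_simps)
  qed
  also have "energy x x' w' + (0 + (?V + (8 * r * Lf\<^sup>2 / \<alpha> / 3 * ?V + measure_pmf.expectation ?R Y4)))
      = lyapunov r x x' w' + measure_pmf.expectation ?R Y4"
    unfolding lyapunov_def weight_def by (simp add: algebra_simps)
  finally show ?thesis unfolding Y4_def by simp
qed

text \<open>
  The law of \<open>(x\<^sub>s, x\<^bsub>s-1\<^esub>, w\<^bsub>s-1\<^esub>)\<close>, in which the coin for \<open>w\<^sub>s\<close> is not yet drawn. Moving the coin from
  the end of a step to the beginning of the next one makes both of its outcomes available for the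
  same batch.
\<close>

fun half_law where
  "half_law x0 0 = return_pmf (x0, x0, x0)"
| "half_law x0 (Suc s) =
     bind_pmf (half_law x0 s) (\<lambda>(x, x', w').
       bind_pmf (bernoulli_pmf p) (\<lambda>coin.
         bind_pmf (replicate_pmf b (Q x w')) (\<lambda>B.
           let w = if coin then x else x' in return_pmf (next_iterate x x' w w' B, x, w))))"

lemma iterate_law_half:
  "iterate_law K g F FO Q f gf \<gamma> p \<alpha> b x0 s =
     bind_pmf (half_law x0 s) (\<lambda>(x, x', w').
       bind_pmf (bernoulli_pmf p) (\<lambda>coin. return_pmf (x, x', if coin then x else x', w')))"
proof (induction s)
  case 0
  then show ?case by (simp add: bind_return_pmf)
next
  case (Suc s)
  show ?case
    unfolding iterate_law.simps Suc half_law.simps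
    by (simp add: bind_assoc_pmf bind_return_pmf case_prod_unfold Let_def next_iterate_def cong: if_cong)
qed

lemma finite_half_law: "finite (set_pmf (half_law x0 s))"
proof (induction s)
  case (Suc s)
  have "finite (set_pmf (bernoulli_pmf p))" by (rule finite_subset[of _ UNIV]) auto
  then show ?case using Suc by (auto simp: Let_def finite_replicate_pmf Q_finite)
qed simp

end

section \<open>Expectation over the coin and summation\<close>

text \<open>
  The descent is only required from index \<open>k\<close> on; the earlier terms go into the constant.
\<close>

lemma descent_summable:
  fixes R U :: "nat \<Rightarrow> real"
  assumes R: "\<And>s. 0 \<le> R s" and U: "\<And>s. 0 \<le> U s" and c: "0 < c"
    and step: "\<And>s. k \<le> s \<Longrightarrow> c * R (Suc s) + U (Suc s) \<le> U s"
  shows "\<exists>C>0. \<forall>S. (\<Sum>s=1..S. R s) \<le> C"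
proof -
  define C where "C = (\<Sum>s=1..k. R s) + U k / c"
  have C: "0 \<le> C" unfolding C_def using R U c by (intro add_nonneg_nonneg sum_nonneg) auto
  have tail: "c * (\<Sum>s=1..k+n. R s) + U (k + n) \<le> c * C" for n
  proof (induction n)
    case (Suc n)
    then show ?case using step[of "k + n"] by (simp add: distrib_left)
  qed (use c in \<open>simp add: C_def distrib_left\<close>)
  have "(\<Sum>s=1..S. R s) \<le> C + 1" for S
  proof -
    have "(\<Sum>s=1..S. R s) \<le> (\<Sum>s=1..k+S. R s)" using R by (intro sum_mono2) auto
    also have "\<dots> \<le> C"
    proof -
      have "c * (\<Sum>s=1..k+S. R s) \<le> c * C" using tail[of S] U[of "k + S"] by linarith
      then show ?thesis using c by simp
    qed
    finally show ?thesis by simp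
  qed
  then show ?thesis using C by (intro exI[of _ "C + 1"]) auto
qed

lemma some_small_iterate:
  fixes a :: "nat \<Rightarrow> real"
  assumes a: "\<And>s. (a s)\<^sup>2 \<le> R s" and C: "0 < C" "\<And>S. (\<Sum>s=1..S. R s) \<le> C" and \<epsilon>: "0 < \<epsilon>"
  shows "\<exists>s\<in>{1..nat \<lceil>C / \<epsilon>\<^sup>2\<rceil>}. a s \<le> \<epsilon>"
proof (rule ccontr)
  assume neg: "\<not> ?thesis"
  let ?S = "nat \<lceil>C / \<epsilon>\<^sup>2\<rceil>"
  have pos: "0 < C / \<epsilon>\<^sup>2" using C \<epsilon> by simp
  then have S: "1 \<le> ?S" "C / \<epsilon>\<^sup>2 \<le> real ?S" by linarith+
  have big: "\<epsilon>\<^sup>2 < R s" if "s \<in> {1..?S}" for s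
  proof -
    have "\<epsilon> < a s" using neg that by force
    then have "\<epsilon>\<^sup>2 < (a s)\<^sup>2" using \<epsilon> by (intro power_strict_mono) auto
    then show ?thesis using a[of s] by simp
  qed
  have "C \<le> real ?S * \<epsilon>\<^sup>2" using S(2) \<epsilon> by (simp add: field_simps)
  also have "\<dots> = (\<Sum>s=1..?S. \<epsilon>\<^sup>2)" by simp
  also have "\<dots> < (\<Sum>s=1..?S. R s)" using big S(1) by (intro sum_strict_mono) auto
  finally show False using C(2)[of ?S] by simp
qed

lemma expectation_power2_le:
  assumes fin: "finite (set_pmf P)"
  shows "(measure_pmf.expectation P h)\<^sup>2 \<le> measure_pmf.expectation P (\<lambda>x. (h x :: real)\<^sup>2)"
proof -
  note int = integrable_measure_pmf_finite[OF fin]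
  define m where "m = measure_pmf.expectation P h"
  have "0 \<le> measure_pmf.expectation P (\<lambda>x. (h x - m)\<^sup>2)" by simp
  also have "\<dots> = measure_pmf.expectation P (\<lambda>x. (h x)\<^sup>2 + (m\<^sup>2 - 2 * m * h x))"
    by (simp add: power2_eq_square algebra_simps)
  also have "\<dots> = measure_pmf.expectation P (\<lambda>x. (h x)\<^sup>2) + (m\<^sup>2 - 2 * m * m)"
    by (subst Bochner_Integration.integral_add[OF int int], subst Bochner_Integration.integral_diff[OF int int])
      (simp add: m_def)
  finally show ?thesis unfolding m_def by (simp add: power2_eq_square)
qed

context vi_scheme
begin

text \<open>
  What the parameters have to guarantee: averaged over the coin, the remaining error terms are
  nonpositive for all distances that satisfy the triangle inequalities and the Lipschitz bound of
  \<open>slack_coin\<close>. The letters are those of \<open>coupled_distances\<close>.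
\<close>

definition coin_dominated where
  "coin_dominated r \<longleftrightarrow> (\<forall>a T H \<tau> \<delta> v. 0 \<le> a \<longrightarrow> 0 \<le> T \<longrightarrow> 0 \<le> \<delta> \<longrightarrow>
     a \<le> \<tau> + \<delta> \<longrightarrow> \<delta> \<le> \<tau> + a \<longrightarrow> T \<le> H + \<delta> \<longrightarrow> \<delta> \<le> H + T \<longrightarrow> v \<le> H + a \<longrightarrow> v \<le> T + \<tau> \<longrightarrow>
     \<delta> \<le> \<alpha> * L * v \<longrightarrow> p * slack r a a H + (1 - p) * slack r T \<tau> T \<le> 0)"

text \<open>
  For the same batch, the estimators of the two outcomes differ by \<open>F(x) - F(x')\<close>.
\<close>

lemma slack_coin:
  assumes coin: "coin_dominated r" and adm: "admissible x x' w'" and len: "length B = b"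
  defines "h \<equiv> next_iterate x x' x w' B" and "t \<equiv> next_iterate x x' x' w' B"
  shows "p * slack r (N (h - x)) (N (h - x)) (N (h - x'))
    + (1 - p) * slack r (N (t - x')) (N (t - x)) (N (t - x')) \<le> 0"
proof -
  have inK: "x \<in> K" "x' \<in> K" using adm by (auto simp: admissible_def)
  have "N (h - t) \<le> \<alpha> * Nd (F x - F x')"
    using prox_step_Lipschitz[OF mirror_average(1)[OF adm], of "F x + oracle_mean x w' B" "F x' + oracle_mean x w' B"]
    by (simp add: h_def t_def next_iterate_def estimator_eq[OF len])
  also have "\<dots> \<le> \<alpha> * (L * N (x - x'))" using F_Lipschitz[OF inK] \<alpha> by (intro mult_left_mono) auto
  finally have d: "N (h - t) \<le> \<alpha> * L * N (x - x')" by simp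
  show ?thesis
    using coin[unfolded coin_dominated_def, rule_format,
        of "N (h - x)" "N (t - x')" "N (h - t)" "N (t - x)" "N (h - x')" "N (x - x')"] d
      N_triangle[of h x t] N_triangle[of h t x] N_triangle[of t x' h] N_triangle[of h t x']
      N_triangle[of h x' t] N_triangle[of x x' h] N_triangle[of x x' t] N_triangle[of x h x'] N_triangle[of x t x']
    by (simp add: N_commute[of x h] N_commute[of x t] N_commute[of x' h] N_commute[of x' t] N_commute[of t h]
        add.commute)
qed

text \<open>
  The batch is drawn from \<open>Q x w'\<close> for both outcomes of the coin, so the two expectations can be
  combined under one integral and compared batch by batch.
\<close>

lemma lyapunov_step:
  assumes coin: "coin_dominated r" and r: "\<rho> \<le> r" and adm: "admissible x x' w'"
    and dom: "x \<in> eff_dom K g" "w' \<in> eff_dom K g"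
  defines "E w \<equiv> measure_pmf.expectation (replicate_pmf b (Q x w'))
      (\<lambda>B. \<alpha> * (r - \<rho>) * (residual (next_iterate x x' w w' B))\<^sup>2 + lyapunov r (next_iterate x x' w w' B) x w)"
  shows "p * E x + (1 - p) * E x' \<le> lyapunov r x x' w'"
proof -
  let ?R = "replicate_pmf b (Q x w')"
  have finR: "finite (set_pmf ?R)" by (intro finite_replicate_pmf Q_finite)
  note int = integrable_measure_pmf_finite[OF finR]
  have inK: "x \<in> K" "x' \<in> K" using adm by (auto simp: admissible_def)
  define Y where "Y w B = slack r (N (next_iterate x x' w w' B - w)) (N (next_iterate x x' w w' B - x))
          (N (next_iterate x x' w w' B - x'))" for w B
  have "p * E x + (1 - p) * E x' \<le> p * (lyapunov r x x' w' + measure_pmf.expectation ?R (Y x))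
      + (1 - p) * (lyapunov r x x' w' + measure_pmf.expectation ?R (Y x'))"
    unfolding E_def Y_def using p lyapunov_batch[OF adm dom inK(1) r] lyapunov_batch[OF adm dom inK(2) r]
    by (intro add_mono mult_left_mono) auto
  also have "\<dots> = lyapunov r x x' w' + (p * measure_pmf.expectation ?R (Y x)
      + (1 - p) * measure_pmf.expectation ?R (Y x'))"
    by (simp add: algebra_simps)
  also have "p * measure_pmf.expectation ?R (Y x) + (1 - p) * measure_pmf.expectation ?R (Y x')
      = measure_pmf.expectation ?R (\<lambda>B. p * Y x B + (1 - p) * Y x' B)"
    by (simp add: Bochner_Integration.integral_add[OF int int])
  also have "\<dots> \<le> measure_pmf.expectation ?R (\<lambda>B. 0)"
    using slack_coin[OF coin adm] unfolding Y_def
    by (intro expectation_mono_finite[OF finR]) (simp add: set_replicate_pmf)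
  finally show ?thesis by simp
qed

lemma half_law_admissible:
  assumes wd: "iterates_well_defined K g F FO Q f gf \<gamma> p \<alpha> b x0" and x0: "x0 \<in> K"
  shows "(x, x', w') \<in> set_pmf (half_law x0 s) \<Longrightarrow> admissible x x' w'"
proof -
  have xx: "x \<in> K \<and> x' \<in> K \<and> \<gamma> *\<^sub>R gf x + (1 - \<gamma>) *\<^sub>R gf x' \<in> gf ` K"
    if "(x, x', w') \<in> set_pmf (half_law x0 s)" for x x' w' s
  proof -
    obtain coin where "coin \<in> set_pmf (bernoulli_pmf p)" using set_pmf_not_empty[of "bernoulli_pmf p"] by blast
    with that have "(x, x', if coin then x else x', w')
        \<in> set_pmf (iterate_law K g F FO Q f gf \<gamma> p \<alpha> b x0 s)"
      unfolding iterate_law_half by force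
    then show ?thesis using wd unfolding iterates_well_defined_def dom_f by blast
  qed
  have "w' \<in> K" if "(x, x', w') \<in> set_pmf (half_law x0 s)" for x x' w'
    using that
  proof (induction s arbitrary: x x' w')
    case 0
    then show ?case using x0 by simp
  next
    case (Suc s)
    then obtain y y' v' where "(y, y', v') \<in> set_pmf (half_law x0 s)" "w' = y \<or> w' = y'"
      by (auto simp: Let_def split: if_splits)
    then show ?case using xx by blast
  qed
  then show "(x, x', w') \<in> set_pmf (half_law x0 s) \<Longrightarrow> admissible x x' w'"
    using xx unfolding admissible_def by blast
qed

text \<open>
  Every proximal step ends in \<open>dom g\<close>, and \<open>w'\<close> is one of the iterates one and two steps back. So the
  starting point, which need not lie in \<open>dom g\<close>, has disappeared after three steps.
\<close>

lemma half_law_dom: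
  assumes wd: "iterates_well_defined K g F FO Q f gf \<gamma> p \<alpha> b x0" and x0: "x0 \<in> K"
  shows "(x, x', w') \<in> set_pmf (half_law x0 s) \<Longrightarrow>
    (1 \<le> s \<longrightarrow> x \<in> eff_dom K g) \<and> (2 \<le> s \<longrightarrow> x' \<in> eff_dom K g) \<and> (3 \<le> s \<longrightarrow> w' \<in> eff_dom K g)"
proof (induction s arbitrary: x x' w')
  case (Suc s)
  then obtain y y' v' w B where y: "(y, y', v') \<in> set_pmf (half_law x0 s)"
    "x = next_iterate y y' w v' B" "x' = y" "w' = y \<or> w' = y'"
    by (auto simp: Let_def split: if_splits)
  have "x \<in> eff_dom K g"
    unfolding y(2) by (rule next_iterate_in[OF half_law_admissible[OF wd x0 y(1)]])
  then show ?case using Suc.IH[OF y(1)] y(3,4) by auto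
qed simp

text \<open>
  After at least one step the set is nonempty, so its distance to 0 is finite and nothing is lost by
  passing to real numbers.
\<close>

lemma half_law_residual:
  assumes wd: "iterates_well_defined K g F FO Q f gf \<gamma> p \<alpha> b x0" and x0: "x0 \<in> K"
    and t: "(x, x', w') \<in> set_pmf (half_law x0 (Suc s))"
  shows "dual_dist0 N (VI_operator K g F x) = ennreal (residual x)"
proof -
  obtain y y' v' w B where y: "(y, y', v') \<in> set_pmf (half_law x0 s)"
    "B \<in> set_pmf (replicate_pmf b (Q y v'))" "x = next_iterate y y' w v' B"
    using t by (auto simp: Let_def split: if_splits)
  from y(2) have "length B = b" by (simp add: set_replicate_pmf)
  from next_iterate_residual[OF half_law_admissible[OF wd x0 y(1)] this refl, of w]
  show ?thesis unfolding y(3) by (rule dual_dist0_residual)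
qed

lemma expected_residual_half:
  assumes wd: "iterates_well_defined K g F FO Q f gf \<gamma> p \<alpha> b x0" and x0: "x0 \<in> K"
  shows "expected_residual N K g F (iterate_law K g F FO Q f gf \<gamma> p \<alpha> b x0 (Suc s))
    = ennreal (measure_pmf.expectation (half_law x0 (Suc s)) (\<lambda>(x, x', w'). residual x))"
proof -
  let ?P = "half_law x0 (Suc s)"
  have "expected_residual N K g F (iterate_law K g F FO Q f gf \<gamma> p \<alpha> b x0 (Suc s))
      = (\<integral>\<^sup>+ (x, x', w'). dual_dist0 N (VI_operator K g F x) \<partial>measure_pmf ?P)"
    unfolding expected_residual_def iterate_law_half nn_integral_bind_pmf
    by (intro nn_integral_cong) (simp add: case_prod_unfold)
  also have "\<dots> = (\<integral>\<^sup>+ (x, x', w'). ennreal (residual x) \<partial>measure_pmf ?P)"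
    using half_law_residual[OF wd x0]
    by (intro nn_integral_cong_AE) (auto simp: AE_measure_pmf_iff simp del: half_law.simps)
  also have "\<dots> = (\<integral>\<^sup>+ t. ennreal (case t of (x, x', w') \<Rightarrow> residual x) \<partial>measure_pmf ?P)"
    by (simp add: case_prod_unfold)
  also have "\<dots> = ennreal (measure_pmf.expectation ?P (\<lambda>(x, x', w'). residual x))"
    by (rule nn_integral_eq_integral)
      (auto intro!: integrable_measure_pmf_finite finite_half_law simp: residual_def simp del: half_law.simps)
  finally show ?thesis .
qed

lemma expected_lyapunov_step:
  assumes coin: "coin_dominated r" and r: "\<rho> \<le> r"
    and wd: "iterates_well_defined K g F FO Q f gf \<gamma> p \<alpha> b x0" and x0: "x0 \<in> K" and s: "3 \<le> s"
  shows "measure_pmf.expectation (half_law x0 (Suc s))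
      (\<lambda>(x, x', w'). \<alpha> * (r - \<rho>) * (residual x)\<^sup>2 + lyapunov r x x' w')
    \<le> measure_pmf.expectation (half_law x0 s) (\<lambda>(x, x', w'). lyapunov r x x' w')"
proof -
  have finB: "finite (set_pmf (bernoulli_pmf p))" by (rule finite_subset[of _ UNIV]) auto
  let ?h = "\<lambda>(x, x', w'). \<alpha> * (r - \<rho>) * (residual x)\<^sup>2 + lyapunov r x x' w'"
  let ?E = "\<lambda>x x' w' w. measure_pmf.expectation (replicate_pmf b (Q x w'))
      (\<lambda>B. \<alpha> * (r - \<rho>) * (residual (next_iterate x x' w w' B))\<^sup>2 + lyapunov r (next_iterate x x' w w' B) x w)"
  have "measure_pmf.expectation (half_law x0 (Suc s)) ?h
    = measure_pmf.expectation (half_law x0 s) (\<lambda>(x, x', w'). p * ?E x x' w' x + (1 - p) * ?E x x' w' x')"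
    unfolding half_law.simps
    by (subst expectation_bind_finite)
      (auto simp: finite_half_law finB finite_replicate_pmf Q_finite expectation_bind_finite p Let_def
        case_prod_unfold mult.commute intro!: Bochner_Integration.integral_cong)
  also have "\<dots> \<le> measure_pmf.expectation (half_law x0 s) (\<lambda>(x, x', w'). lyapunov r x x' w')"
  proof (rule expectation_mono_finite[OF finite_half_law], clarify)
    fix x x' w' assume t: "(x, x', w') \<in> set_pmf (half_law x0 s)"
    show "p * ?E x x' w' x + (1 - p) * ?E x x' w' x' \<le> lyapunov r x x' w'"
      using half_law_dom[OF wd x0 t] s
      by (intro lyapunov_step[OF coin r half_law_admissible[OF wd x0 t]]) auto
  qed
  finally show ?thesis .
qed

lemma complexity:
  assumes coin: "coin_dominated r" and r: "\<rho> < r"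
    and wd: "iterates_well_defined K g F FO Q f gf \<gamma> p \<alpha> b x0" and x0: "x0 \<in> K"
  shows "\<exists>C>0. \<forall>\<epsilon>>0. \<exists>s\<in>{1..nat \<lceil>C / \<epsilon>\<^sup>2\<rceil>}.
    expected_residual N K g F (iterate_law K g F FO Q f gf \<gamma> p \<alpha> b x0 s) \<le> ennreal \<epsilon>"
proof -
  define a where "a s = measure_pmf.expectation (half_law x0 s) (\<lambda>(x, x', w'). residual x)" for s
  define R where "R s = measure_pmf.expectation (half_law x0 s) (\<lambda>(x, x', w'). (residual x)\<^sup>2)" for s
  define U where "U s = measure_pmf.expectation (half_law x0 s) (\<lambda>(x, x', w'). lyapunov r x x' w')" for s
  note int = integrable_measure_pmf_finite[OF finite_half_law]
  have aR: "(a s)\<^sup>2 \<le> R s" for s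
    using expectation_power2_le[OF finite_half_law, of x0 s "\<lambda>(x, x', w'). residual x"]
    unfolding a_def R_def by (simp add: case_prod_unfold)
  have "\<exists>C>0. \<forall>S. (\<Sum>s=1..S. R s) \<le> C"
  proof (rule descent_summable[where U = U and c = "\<alpha> * (r - \<rho>)" and k = 3])
    show "0 \<le> R s" for s using aR[of s] by (meson order_trans zero_le_power2)
    show "0 \<le> U s" for s
    proof -
      have "measure_pmf.expectation (half_law x0 s) (\<lambda>_. 0) \<le> U s"
        unfolding U_def
      proof (rule expectation_mono_finite[OF finite_half_law], clarify)
        fix x x' w' assume "(x, x', w') \<in> set_pmf (half_law x0 s)"
        then show "0 \<le> lyapunov r x x' w'"
          using lyapunov_nonneg[OF half_law_admissible[OF wd x0]] \<rho> r by simp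
      qed
      then show ?thesis by simp
    qed
    show "0 < \<alpha> * (r - \<rho>)" using \<alpha> r by simp
    fix s :: nat assume s: "3 \<le> s"
    have "\<alpha> * (r - \<rho>) * R (Suc s) + U (Suc s) = measure_pmf.expectation (half_law x0 (Suc s))
        (\<lambda>t. \<alpha> * (r - \<rho>) * (case t of (x, x', w') \<Rightarrow> (residual x)\<^sup>2) + (case t of (x, x', w') \<Rightarrow> lyapunov r x x' w'))"
      unfolding R_def U_def by (subst Bochner_Integration.integral_add[OF int int]) simp
    also have "\<dots> \<le> U s"
      using expected_lyapunov_step[OF coin less_imp_le[OF r] wd x0 s]
      unfolding U_def by (simp add: case_prod_unfold del: half_law.simps)
    finally show "\<alpha> * (r - \<rho>) * R (Suc s) + U (Suc s) \<le> U s" .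
  qed
  then obtain C where C: "0 < C" "\<And>S. (\<Sum>s=1..S. R s) \<le> C" by blast
  have "\<exists>s\<in>{1..nat \<lceil>C / \<epsilon>\<^sup>2\<rceil>}.
    expected_residual N K g F (iterate_law K g F FO Q f gf \<gamma> p \<alpha> b x0 s) \<le> ennreal \<epsilon>" if \<epsilon>: "0 < \<epsilon>" for \<epsilon>
  proof -
    obtain s where s: "s \<in> {1..nat \<lceil>C / \<epsilon>\<^sup>2\<rceil>}" "a s \<le> \<epsilon>"
      using some_small_iterate[OF aR C \<epsilon>] by blast
    then obtain n where "s = Suc n" by (cases s) auto
    then have "expected_residual N K g F (iterate_law K g F FO Q f gf \<gamma> p \<alpha> b x0 s) \<le> ennreal \<epsilon>"
      using s(2) expected_residual_half[OF wd x0, of n] unfolding a_def by (simp add: ennreal_leI del: half_law.simps)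
    then show ?thesis using s(1) by blast
  qed
  then show ?thesis using C(1) by blast
qed

end

section \<open>The parameter conditions and the complexity bound\<close>

context vi_scheme
begin

text \<open>
  Compares the error coefficient with the subtracted terms of \<open>\<sigma>\<^sub>1\<close>; the factor \<open>7/12\<close> is what
  \<open>coin_average\<close> requires.
\<close>

lemma weight_le:
  assumes r: "0 < r" and \<kappa>: "8 * r * Lf\<^sup>2 / \<alpha> \<le> 1/2"
  shows "weight r + 8/3 * \<alpha> * r * L\<^sup>2 \<le> 7/12 * (2 * \<alpha>\<^sup>2 * L\<^sup>2 + 8 * \<alpha> * r * L\<^sup>2
     + 4 * \<alpha> * r * Lbar\<^sup>2 / real b + 5 * \<alpha>\<^sup>2 * Lbar\<^sup>2 / (2 * real b))"
proof -
  define l where "l = \<alpha>\<^sup>2 * L\<^sup>2"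
  define \<beta> where "\<beta> = \<alpha>\<^sup>2 * Lbar\<^sup>2 / real b"
  define u where "u = \<alpha> * r * L\<^sup>2"
  define v where "v = \<alpha> * r * Lbar\<^sup>2 / real b"
  have nonneg: "0 \<le> l" "0 \<le> \<beta>" "0 \<le> u" "0 \<le> v"
    using \<alpha> r by (simp_all add: l_def \<beta>_def u_def v_def)
  have "weight r \<le> 7/6 * (l + \<beta>)"
    unfolding weight_def l_def[symmetric] \<beta>_def[symmetric]
    using \<kappa> nonneg by (intro mult_right_mono) auto
  then have "weight r + 8/3 * \<alpha> * r * L\<^sup>2 \<le> 7/6 * (l + \<beta>) + 8/3 * u"
    unfolding u_def by (simp only: mult.assoc add_le_cancel_right)
  also have "\<dots> \<le> 7/12 * (2 * l + 8 * u + 4 * v + 5/2 * \<beta>)" using nonneg by simp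
  also have "2 * l + 8 * u + 4 * v + 5/2 * \<beta> = 2 * \<alpha>\<^sup>2 * L\<^sup>2 + 8 * \<alpha> * r * L\<^sup>2
     + 4 * \<alpha> * r * Lbar\<^sup>2 / real b + 5 * \<alpha>\<^sup>2 * Lbar\<^sup>2 / (2 * real b)"
    by (simp add: l_def \<beta>_def u_def v_def)
  finally show ?thesis .
qed

text \<open>
  With \<open>c = (\<gamma> - p) / (1 - p)\<close> and \<open>\<kappa> = 8 r L\<^sub>f\<^sup>2 / \<alpha>\<close>, one has \<open>\<gamma> = c + p (1 - c)\<close> and
  \<open>1 - \<gamma> = (1 - p) (1 - c)\<close>. So for \<open>m = (1 - c) (1 - \<kappa>) / 2\<close> the two negative coefficients in \<open>slack\<close> are at
  least \<open>p m\<close> and exactly \<open>(1 - p) m\<close>, which are the weights of \<open>coin_average\<close>, scaled by \<open>m\<close>. Since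
  \<open>c (1 - \<kappa>) > 1/2\<close> forces \<open>m \<le> 1/4\<close>, the step size satisfies \<open>(\<alpha> L)\<^sup>2 \<le> 1/8\<close>, as \<open>coupled_distances\<close>
  needs.
\<close>

lemma coin_dominated_random:
  assumes r: "0 < r" and p1: "p < 1"
    and gap: "(\<gamma> - p) / (1 - p) * (1 - 8 * r * Lf\<^sup>2 / \<alpha>) > 1/2"
    and \<sigma>: "(1 - \<gamma>) / (2 * (1 - p)) * (1 - 8 * r * Lf\<^sup>2 / \<alpha>)
        - (2 * \<alpha>\<^sup>2 * L\<^sup>2 + 8 * \<alpha> * r * L\<^sup>2 + 4 * \<alpha> * r * Lbar\<^sup>2 / real b
           + 5 * \<alpha>\<^sup>2 * Lbar\<^sup>2 / (2 * real b)) > 0"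
  shows "coin_dominated r"
proof -
  define \<kappa> where "\<kappa> = 8 * r * Lf\<^sup>2 / \<alpha>"
  define c where "c = (\<gamma> - p) / (1 - p)"
  define m where "m = (1 - c) * (1 - \<kappa>) / 2"
  define G where "G = weight r + 8/3 * \<alpha> * r * L\<^sup>2"
  have \<kappa>0: "0 \<le> \<kappa>" unfolding \<kappa>_def using r \<alpha> by simp
  have c1: "1 - c = (1 - \<gamma>) / (1 - p)" unfolding c_def using p1 by (simp add: field_simps)
  then have c_le: "c \<le> 1" using p1 \<gamma>(2) by (smt (verit) divide_nonneg_nonneg)
  have gap': "c * (1 - \<kappa>) > 1/2" using gap unfolding c_def \<kappa>_def .
  define s where "s = 2 * \<alpha>\<^sup>2 * L\<^sup>2 + 8 * \<alpha> * r * L\<^sup>2 + 4 * \<alpha> * r * Lbar\<^sup>2 / real b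
           + 5 * \<alpha>\<^sup>2 * Lbar\<^sup>2 / (2 * real b)"
  have s_m: "s < m" using \<sigma> p1 unfolding s_def \<kappa>_def[symmetric] m_def c1 by (simp add: mult.commute)
  have "0 \<le> s" unfolding s_def using \<alpha> r by simp
  then have "0 < (1 - c) * (1 - \<kappa>)" using s_m unfolding m_def by linarith
  then have \<kappa>1: "0 < 1 - \<kappa>" using c_le by (auto simp: zero_less_mult_iff)
  then have "c * (1 - \<kappa>) \<le> 1 - \<kappa>" using c_le by (simp add: mult_left_le_one_le)
  then have \<kappa>_half: "\<kappa> \<le> 1/2" using gap' by simp
  have G: "G \<le> 7/12 * m"
    using weight_le[OF r] \<kappa>_half s_m unfolding G_def \<kappa>_def[symmetric] s_def[symmetric] by linarith
  have m0: "0 \<le> m" unfolding m_def using c_le \<kappa>_half by simp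
  have "(1 - c) * (1 - \<kappa>) = (1 - \<kappa>) - c * (1 - \<kappa>)" by (simp add: left_diff_distrib)
  then have m_quarter: "m \<le> 1/4" unfolding m_def using gap' \<kappa>0 by simp
  have l: "(\<alpha> * L)\<^sup>2 \<le> 1/8"
  proof -
    have "2 * \<alpha>\<^sup>2 * L\<^sup>2 \<le> s" unfolding s_def using \<alpha> r b by simp
    then show ?thesis using s_m m_quarter by (simp add: power_mult_distrib)
  qed
  have cfg: "\<gamma> = c + p * (1 - c)"
  proof -
    have "c * (1 - p) = \<gamma> - p" unfolding c_def using p1 by simp
    then show ?thesis by (simp add: algebra_simps)
  qed
  have w3: "(1 - \<gamma>) * (1 - \<kappa>) / 2 = (1 - p) * m"
  proof -
    have "1 - \<gamma> = (1 - p) * (1 - c)" unfolding c1 using p1 by simp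
    then show ?thesis by (simp add: m_def)
  qed
  have w2: "p * m \<le> (\<gamma> * (1 - \<kappa>) - 1/2) / 2"
  proof -
    have "\<gamma> * (1 - \<kappa>) = c * (1 - \<kappa>) + p * ((1 - c) * (1 - \<kappa>))"
      by (subst cfg) (simp add: algebra_simps)
    also have "p * ((1 - c) * (1 - \<kappa>)) = 2 * (p * m)" by (simp add: m_def)
    finally show ?thesis using gap' by simp
  qed
  show ?thesis
    unfolding coin_dominated_def
  proof (intro allI impI)
    fix a T H \<tau> \<delta> v :: real
    assume h: "0 \<le> a" "0 \<le> T" "0 \<le> \<delta>" "a \<le> \<tau> + \<delta>" "\<delta> \<le> \<tau> + a" "T \<le> H + \<delta>" "\<delta> \<le> H + T"
      "v \<le> H + a" "v \<le> T + \<tau>" "\<delta> \<le> \<alpha> * L * v"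
    have "7/12 * (p * a\<^sup>2 + (1 - p) * T\<^sup>2)
        \<le> p * (p * a\<^sup>2 + (1 - p) * H\<^sup>2) + (1 - p) * (p * \<tau>\<^sup>2 + (1 - p) * T\<^sup>2)"
      using \<alpha> L l h by (intro coin_average[OF p] coupled_distances[where \<delta> = \<delta> and l = "\<alpha> * L" and v = v]) auto
    from mult_left_mono[OF this m0]
    have "7/12 * m * (p * a\<^sup>2 + (1 - p) * T\<^sup>2)
        \<le> p * ((p * m) * a\<^sup>2 + ((1 - p) * m) * H\<^sup>2) + (1 - p) * ((p * m) * \<tau>\<^sup>2 + ((1 - p) * m) * T\<^sup>2)"
      by (simp add: algebra_simps)
    moreover have "G * (p * a\<^sup>2 + (1 - p) * T\<^sup>2) \<le> 7/12 * m * (p * a\<^sup>2 + (1 - p) * T\<^sup>2)"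
      using G p by (intro mult_right_mono) auto
    moreover have "p * ((p * m) * a\<^sup>2) \<le> p * ((\<gamma> * (1 - \<kappa>) - 1/2) / 2 * a\<^sup>2)"
      "(1 - p) * ((p * m) * \<tau>\<^sup>2) \<le> (1 - p) * ((\<gamma> * (1 - \<kappa>) - 1/2) / 2 * \<tau>\<^sup>2)"
      using w2 p by (intro mult_left_mono mult_right_mono; simp)+
    ultimately show "p * slack r a a H + (1 - p) * slack r T \<tau> T \<le> 0"
      unfolding slack_def G_def[symmetric] \<kappa>_def[symmetric] w3 by (simp only: distrib_left right_diff_distrib) argo
  qed
qed

text \<open>
  For \<open>p = 1\<close> the point \<open>w\<close> is always the current iterate, and the coefficients of its squared distance
  to the next one can be compared directly.
\<close>

lemma coin_dominated_certain:
  assumes r: "0 < r" and p1: "p = 1"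
    and \<sigma>: "(\<gamma> - 1/2) - (4 * \<alpha>\<^sup>2 * L\<^sup>2 + 16 * \<alpha> * r * L\<^sup>2 + 8 * \<alpha> * r * Lbar\<^sup>2 / real b
           + 5 * \<alpha>\<^sup>2 * Lbar\<^sup>2 / real b + 8 * \<gamma> * r * Lf\<^sup>2 / \<alpha>) > 0"
  shows "coin_dominated r"
proof -
  define \<kappa> where "\<kappa> = 8 * r * Lf\<^sup>2 / \<alpha>"
  define s where "s = 2 * \<alpha>\<^sup>2 * L\<^sup>2 + 8 * \<alpha> * r * L\<^sup>2 + 4 * \<alpha> * r * Lbar\<^sup>2 / real b
           + 5 * \<alpha>\<^sup>2 * Lbar\<^sup>2 / (2 * real b)"
  have s0: "0 \<le> s" unfolding s_def using \<alpha> r by simp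
  have "8 * \<gamma> * r * Lf\<^sup>2 / \<alpha> = \<gamma> * \<kappa>" unfolding \<kappa>_def by simp
  moreover have "4 * \<alpha>\<^sup>2 * L\<^sup>2 + 16 * \<alpha> * r * L\<^sup>2 + 8 * \<alpha> * r * Lbar\<^sup>2 / real b + 5 * \<alpha>\<^sup>2 * Lbar\<^sup>2 / real b = 2 * s"
    unfolding s_def using b by (simp add: field_simps)
  ultimately have s_lt: "2 * s < \<gamma> - 1/2 - \<gamma> * \<kappa>" using \<sigma> by simp
  have \<kappa>_half: "\<kappa> \<le> 1/2"
  proof (rule ccontr)
    assume "\<not> ?thesis"
    then have "\<gamma> * (1/2) \<le> \<gamma> * \<kappa>" using \<gamma> by (intro mult_left_mono) auto
    then show False using s_lt s0 \<gamma> by linarith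
  qed
  have G: "weight r + 8/3 * \<alpha> * r * L\<^sup>2 \<le> (\<gamma> * (1 - \<kappa>) - 1/2) / 2"
  proof -
    have "weight r + 8/3 * \<alpha> * r * L\<^sup>2 \<le> 7/12 * s"
      using weight_le[OF r] \<kappa>_half unfolding \<kappa>_def s_def by blast
    also have "\<dots> \<le> (\<gamma> - \<gamma> * \<kappa> - 1/2) / 2" using s_lt s0 by simp
    finally show ?thesis by (simp add: right_diff_distrib)
  qed
  have "slack r a a H \<le> 0" for a H
  proof -
    have "(weight r + 8/3 * \<alpha> * r * L\<^sup>2) * a\<^sup>2 \<le> (\<gamma> * (1 - \<kappa>) - 1/2) / 2 * a\<^sup>2"
      using G by (rule mult_right_mono) simp
    moreover have "0 \<le> (1 - \<gamma>) * (1 - \<kappa>) / 2 * H\<^sup>2" using \<gamma> \<kappa>_half by simp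
    ultimately show ?thesis unfolding slack_def \<kappa>_def[symmetric] by linarith
  qed
  then show ?thesis unfolding coin_dominated_def using p1 by simp
qed

end

theorem corollary3p2:
  fixes N :: "'a::euclidean_space \<Rightarrow> real"
    and K :: "'a set"
    and g f :: "'a \<Rightarrow> ereal"
    and F gf :: "'a \<Rightarrow> 'a"
    and M b :: nat
    and Fc FO :: "nat \<Rightarrow> 'a \<Rightarrow> 'a"
    and Q :: "'a \<Rightarrow> 'a \<Rightarrow> nat pmf"
    and \<gamma> p \<alpha> \<rho> L Lbar L\<^sub>f :: real
    and \<sigma>1 \<sigma>2 \<sigma>1' \<sigma>2' :: real
    and xstar x0 :: 'a
  assumes norm: "is_norm N"
    and K: "K \<noteq> {}" "closed K" "convex K"
    and g: "proper_on K g" "ereal_convex_on K g" "lsc_on K g"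
    and F_sum: "M \<ge> 1" "\<And>x. x \<in> eff_dom K g \<Longrightarrow> F x = (1 / real M) *\<^sub>R (\<Sum>i=1..M. Fc i x)"
    and f: "proper_on K f" "ereal_convex_on K f" "lsc_on K f" "eff_dom K g \<subseteq> eff_dom K f"
      "gradient_on_dom_subdiff K f gf" "strongly_convex_1 N K f gf"
    and params: "0 < \<gamma>" "\<gamma> \<le> 1" "0 < p" "p \<le> 1" "0 < \<alpha>" "1 \<le> b" "b \<le> M"
    and x0: "x0 \<in> K"
    and well_defined: "iterates_well_defined K g F FO Q f gf \<gamma> p \<alpha> b x0"
    and A1: "VI_solutions K g F \<noteq> {}"
    and A3: "variable_Lipschitz_oracle N K g F M FO Q Lbar"
    and A4: "\<And>x y. x \<in> K \<Longrightarrow> y \<in> K \<Longrightarrow> dual_norm N (F x - F y) \<le> L * N (x - y)"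
    and A5: "xstar \<in> K" "\<rho> > 0"
      "\<And>x w. x \<in> K \<Longrightarrow> w \<in> VI_operator K g F x \<Longrightarrow>
         - \<rho> * (dual_norm N w)\<^sup>2 \<le> w \<bullet> (x - xstar)"
    and A6: "L\<^sub>f > 0" "K \<subseteq> dom_subdiff K f"
      "\<And>x y. x \<in> K \<Longrightarrow> y \<in> K \<Longrightarrow> dual_norm N (gf x - gf y) \<le> L\<^sub>f * N (x - y)"
    and \<sigma>1: "\<sigma>1 = (1 - \<gamma>) / (2 * (1 - p)) * (1 - 8 * \<rho> * L\<^sub>f\<^sup>2 / \<alpha>)
        - (2 * \<alpha>\<^sup>2 * L\<^sup>2 + 8 * \<alpha> * \<rho> * L\<^sup>2 + 4 * \<alpha> * \<rho> * Lbar\<^sup>2 / real b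
           + 5 * \<alpha>\<^sup>2 * Lbar\<^sup>2 / (2 * real b))"
    and \<sigma>2: "\<sigma>2 = 8 * L\<^sup>2 + 4 * (1 - \<gamma>) * L\<^sub>f\<^sup>2 / ((1 - p) * \<alpha>\<^sup>2) + 4 * Lbar\<^sup>2 / real b"
    and \<sigma>1': "\<sigma>1' = (\<gamma> - 1/2)
        - (4 * \<alpha>\<^sup>2 * L\<^sup>2 + 16 * \<alpha> * \<rho> * L\<^sup>2 + 8 * \<alpha> * \<rho> * Lbar\<^sup>2 / real b
           + 5 * \<alpha>\<^sup>2 * Lbar\<^sup>2 / real b + 8 * \<gamma> * \<rho> * L\<^sub>f\<^sup>2 / \<alpha>)"
    and \<sigma>2': "\<sigma>2' = 16 * L\<^sup>2 + 8 * \<gamma> * L\<^sub>f\<^sup>2 / \<alpha>\<^sup>2 + 8 * Lbar\<^sup>2 / real b"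
    and cases_a_b:
      "(0 < p \<and> p < 1 \<and> p < \<gamma> \<and> \<gamma> < 1 \<and> \<sigma>1 > 0 \<and>
        8 * (\<gamma> - p) * L\<^sub>f\<^sup>2 / ((1 - p) * \<alpha>\<^sup>2)
          - \<sigma>2 / \<sigma>1 * ((\<gamma> - p) / (1 - p) * (1 - 8 * \<rho> * L\<^sub>f\<^sup>2 / \<alpha>) - 1/2) \<le> 0)
       \<or>
       (p = 1 \<and> \<sigma>1' > 0 \<and>
        (1 - \<gamma>) * (\<sigma>1' / \<sigma>2' * (8 * \<rho> * L\<^sub>f\<^sup>2 / \<alpha> - 1) + 8 * L\<^sub>f\<^sup>2 / \<alpha>\<^sup>2) \<le> 0)"
  shows "\<exists>C>0. \<forall>\<epsilon>>0. \<exists>s\<in>{1..nat \<lceil>C / \<epsilon>\<^sup>2\<rceil>}.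
           expected_residual N K g F (iterate_law K g F FO Q f gf \<gamma> p \<alpha> b x0 s) \<le> ennreal \<epsilon>"
proof -
  have domf: "dom_subdiff K f = K" using A6(2) by (auto simp: dom_subdiff_def eff_dom_def)
  then have efff: "eff_dom K f = K" by (auto simp: dom_subdiff_def eff_dom_def)
  have f_real: "f x = ereal (real_of_ereal (f x))" if "x \<in> K" for x
  proof -
    have "x \<in> eff_dom K f" using that efff by simp
    then show ?thesis using f(1) unfolding eff_dom_def proper_on_def by (cases "f x") auto
  qed
  have strong: "(N (x - y))\<^sup>2 / 2 \<le> bregman f gf x y" if xy: "x \<in> K" "y \<in> K" for x y
  proof -
    obtain a b where ab: "f x = ereal a" "f y = ereal b" using f_real[OF xy(1)] f_real[OF xy(2)] by blast
    have "f y + ereal (gf y \<bullet> (x - y) + 1/2 * (N (x - y))\<^sup>2) \<le> f x"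
      using f(6) xy unfolding strongly_convex_1_def domf efff by blast
    then show ?thesis using ab by (simp add: bregman_def)
  qed
  \<comment> \<open>Since \<open>\<sigma>2 / \<sigma>1\<close> is positive, the second inequality of the first alternative yields a strict lower
    bound on its last factor. All bounds are strict and continuous in \<open>\<rho>\<close>, so they persist for some
    larger \<open>r\<close>.\<close>
  have key: "\<gamma> \<ge> 1/2 \<and> (\<exists>r>\<rho>. (p < 1 \<and> (\<gamma> - p) / (1 - p) * (1 - 8 * r * L\<^sub>f\<^sup>2 / \<alpha>) > 1/2 \<and>
      (1 - \<gamma>) / (2 * (1 - p)) * (1 - 8 * r * L\<^sub>f\<^sup>2 / \<alpha>)
        - (2 * \<alpha>\<^sup>2 * L\<^sup>2 + 8 * \<alpha> * r * L\<^sup>2 + 4 * \<alpha> * r * Lbar\<^sup>2 / real b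
           + 5 * \<alpha>\<^sup>2 * Lbar\<^sup>2 / (2 * real b)) > 0) \<or>
      (p = 1 \<and> (\<gamma> - 1/2) - (4 * \<alpha>\<^sup>2 * L\<^sup>2 + 16 * \<alpha> * r * L\<^sup>2 + 8 * \<alpha> * r * Lbar\<^sup>2 / real b
           + 5 * \<alpha>\<^sup>2 * Lbar\<^sup>2 / real b + 8 * \<gamma> * r * L\<^sub>f\<^sup>2 / \<alpha>) > 0))"
    (is "_ \<and> (\<exists>r>\<rho>. (p < 1 \<and> ?gap r > 1/2 \<and> ?s1 r > 0) \<or> (p = 1 \<and> ?s2 r > 0))")
    using cases_a_b
  proof (elim disjE conjE)
    assume p: "p < 1" "p < \<gamma>" "\<gamma> < 1" and s1: "\<sigma>1 > 0"
      and le: "8 * (\<gamma> - p) * L\<^sub>f\<^sup>2 / ((1 - p) * \<alpha>\<^sup>2) - \<sigma>2 / \<sigma>1 * (?gap \<rho> - 1/2) \<le> 0"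
    have "0 < 8 * (\<gamma> - p) * L\<^sub>f\<^sup>2 / ((1 - p) * \<alpha>\<^sup>2)" using p A6(1) params by simp
    then have pos: "0 < \<sigma>2 / \<sigma>1 * (?gap \<rho> - 1/2)" using le by linarith
    have "0 < 4 * (1 - \<gamma>) * L\<^sub>f\<^sup>2 / ((1 - p) * \<alpha>\<^sup>2)" using p A6(1) params by simp
    then have "0 < \<sigma>2" unfolding \<sigma>2 by (simp add: add_nonneg_pos add_pos_nonneg)
    then have "0 < \<sigma>2 / \<sigma>1" using s1 by simp
    from zero_less_mult_pos[OF pos this] have gap: "?gap \<rho> > 1/2" by linarith
    have "(\<gamma> - p) / (1 - p) * (1 - 8 * \<rho> * L\<^sub>f\<^sup>2 / \<alpha>) \<le> (\<gamma> - p) / (1 - p) * 1"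
      using p params A5(2) by (intro mult_left_mono) auto
    from less_le_trans[OF gap this] have half: "1/2 < (\<gamma> - p) / (1 - p)" by simp
    have "(\<gamma> - p) / (1 - p) \<le> \<gamma>"
    proof -
      have "p * \<gamma> \<le> p" using params p by (simp add: mult_left_le)
      then show ?thesis using p by (simp add: divide_le_eq algebra_simps)
    qed
    then have g: "\<gamma> \<ge> 1/2" using half by linarith
    have "eventually (\<lambda>r. ?gap r > 1/2) (at_right \<rho>)"
      by (rule order_tendstoD[OF _ gap]) (use params p in \<open>auto intro!: tendsto_intros\<close>)
    moreover have "eventually (\<lambda>r. ?s1 r > 0) (at_right \<rho>)"
      by (rule order_tendstoD[OF _ s1[unfolded \<sigma>1]]) (use params p in \<open>auto intro!: tendsto_intros\<close>)
    moreover have "eventually (\<lambda>r. r > \<rho>) (at_right \<rho>)" by (rule eventually_at_right_less)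
    ultimately have "eventually (\<lambda>r. r > \<rho> \<and> ?gap r > 1/2 \<and> ?s1 r > 0) (at_right \<rho>)"
      by eventually_elim auto
    then obtain r where "r > \<rho> \<and> ?gap r > 1/2 \<and> ?s1 r > 0"
      using eventually_happens[of _ "at_right \<rho>"] by auto
    then show ?thesis using p(1) g by blast
  next
    assume p: "p = 1" and s2: "\<sigma>1' > 0"
    have "0 \<le> 4 * \<alpha>\<^sup>2 * L\<^sup>2 + 16 * \<alpha> * \<rho> * L\<^sup>2 + 8 * \<alpha> * \<rho> * Lbar\<^sup>2 / real b
           + 5 * \<alpha>\<^sup>2 * Lbar\<^sup>2 / real b + 8 * \<gamma> * \<rho> * L\<^sub>f\<^sup>2 / \<alpha>"
      using params A5(2) by (intro add_nonneg_nonneg) auto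
    then have g: "\<gamma> \<ge> 1/2" using s2 unfolding \<sigma>1' by linarith
    have "eventually (\<lambda>r. ?s2 r > 0) (at_right \<rho>)"
      by (rule order_tendstoD[OF _ s2[unfolded \<sigma>1']]) (use params in \<open>auto intro!: tendsto_intros\<close>)
    moreover have "eventually (\<lambda>r. r > \<rho>) (at_right \<rho>)" by (rule eventually_at_right_less)
    ultimately have "eventually (\<lambda>r. r > \<rho> \<and> ?s2 r > 0) (at_right \<rho>)"
      by eventually_elim auto
    then obtain r where "r > \<rho> \<and> ?s2 r > 0"
      using eventually_happens[of _ "at_right \<rho>"] by auto
    then show ?thesis using p g by blast
  qed
  then obtain r where r: "r > \<rho>" and rr: "(p < 1 \<and> ?gap r > 1/2 \<and> ?s1 r > 0) \<or> (p = 1 \<and> ?s2 r > 0)"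
    by blast
  interpret dual_pair N by unfold_locales (rule norm)
  \<comment> \<open>A negative \<open>L\<close> is possible when \<open>K\<close> is a single point; all conditions involve \<open>L\<^sup>2\<close> only.\<close>
  interpret vi_scheme N K f gf g F FO Q \<gamma> p \<alpha> "\<bar>L\<bar>" Lbar "L\<^sub>f" \<rho> b xstar
  proof
    fix x assume "x \<in> K"
    then show "((\<lambda>z. real_of_ereal (f z)) has_derivative (\<lambda>h. gf x \<bullet> h)) (at x within K)"
      using f(5) unfolding gradient_on_dom_subdiff_def domf efff by blast
  next
    fix x y
    have "set_pmf (Q x y) \<subseteq> {1..M}" using A3 unfolding variable_Lipschitz_oracle_def by blast
    then show "finite (set_pmf (Q x y))" by (rule finite_subset) simp
  next
    fix x y assume xy: "x \<in> K" "y \<in> K"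
    have "L * N (x - y) \<le> \<bar>L\<bar> * N (x - y)" by (intro mult_right_mono) auto
    then show "dual_norm N (F x - F y) \<le> \<bar>L\<bar> * N (x - y)" using A4[OF xy] by linarith
  next
    fix x y z assume "x \<in> eff_dom K g" "y \<in> eff_dom K g" "z \<in> eff_dom K g"
    then show "F z = measure_pmf.expectation (Q x y) (\<lambda>\<xi>. FO \<xi> z)"
      using A3 unfolding variable_Lipschitz_oracle_def by blast
  next
    fix x y assume "x \<in> eff_dom K g" "y \<in> eff_dom K g"
    then show "measure_pmf.expectation (Q x y) (\<lambda>\<xi>. (dual_norm N (FO \<xi> x - FO \<xi> y))\<^sup>2)
        \<le> Lbar\<^sup>2 * (N (x - y))\<^sup>2"
      using A3 unfolding variable_Lipschitz_oracle_def by blast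
  next
    show "1/2 \<le> \<gamma>" using key by blast
  next
    show "0 \<le> p" using params by simp
  qed (fact K g params A5 A6(3) domf strong | simp)+
  have "coin_dominated r"
    using rr
  proof (elim disjE conjE)
    assume "p < 1" "?gap r > 1/2" "?s1 r > 0"
    then show ?thesis using r A5(2) params by (intro coin_dominated_random) auto
  next
    assume "p = 1" "?s2 r > 0"
    then show ?thesis using r A5(2) by (intro coin_dominated_certain) auto
  qed
  then show ?thesis using complexity r well_defined x0 by blast
qed

end
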